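(* Suppose that a factored-observation stochastic game $G$ has observable rewards, i.e., that $\mathcal R_i(h)=\mathcal R_i(h')$ whenever $s_i(h)=s_i(h')$. Then running CFR (counterfactual regret minimization) on $G$ yields the same strategy as running CFR on $E'=\mathtt{ClassicalEFG}(G)$.
   Context: **FOSG.** A factored-observation stochastic game (FOSG) is a tuple $G=\langle \mathcal N,\mathcal W,p,w^{\mathrm{init}},\mathcal A,\mathcal T,\mathcal R,\mathcal O\rangle$ (with $\mathcal T,\mathcal R,\mathcal O$ partial functions), where: $\mathcal N=\{1,\dots,N\}$ is the player set; $\mathcal W$ is a compact set of world states with initial state $w^{\mathrm{init}}$; $p:\mathcal W\to 2^{\mathcal N}$ gives the active players, with $p(w^{\mathrm{init}})=\emptyset$; $\mathcal A=\prod_{i\in\mathcal N}\mathcal A_i$; for $i\in p(w)$, $\mathcal A_i(w)\subset\mathcal A_i$ is a non-empty compact set of legal actions, for $i\notin p(w)$, $\mathcal A_i(w)=\{noop\}$, and $\mathcal A(w)=\prod_{i\in p(w)}\mathcal A_i(w)$ (identified with $\prod_{i\in\mathcal N}\mathcal A_i(w)$); $\mathcal T(w,a)\in\Delta\mathcal W$ for $a\in\mathcal A(w)$ is defined for all $w$ with $p(w)\ne\emptyset$ and for some $w$ with $p(w)=\emptyset$; a state with $p(w)=\emptyset$ and undefined $\mathcal T$ is terminal; $\mathcal R(w,a)=(\mathcal R_i(w,a))_{i\in\mathcal N}\in\mathbb R^{\mathcal N}$ for non-terminal $w$ and $a\in\mathcal A(w)$; $\mathcal O=(\mathcal O_{\mathrm{priv}(1)},\dots,\mathcal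 O_{\mathrm{priv}(N)},\mathcal O_{\mathrm{pub}})$ is the observation function, each component $\mathcal O_{(\cdot)}(w,a,w')$ being defined for non-terminal $w$, $a\in\mathcal A(w)$, $w'\in\operatorname{supp}\mathcal T(w,a)$. Put $\mathcal O_i=(\mathcal O_{\mathrm{priv}(i)},\mathcal O_{\mathrm{pub}})$. A history is a finite sequence $h=w^0a^0w^1\dots w^t$ with $w^0=w^{\mathrm{init}}$, $a^k\in\mathcal A(w^k)$, $w^{k+1}\in\operatorname{supp}\mathcal T(w^k,a^k)$; $\mathcal H$ is the tree of all histories; $\mathcal R_i(h)=\sum_{k<t}\mathcal R_i(w^k,a^k)$ is the cumulative reward (similarly for trajectories starting at other states); notation for world states is applied to histories via their last state. The information state $s_i(h)$ is the sequence obtained by starting with the empty sequence and, at each transition along $h$, appending $i$'s action (if not $noop$) and then the observation $\mathcal O_i$. Standing assumptions: $s_i(g)=s_i(h)$ implies $\mathcal A_i(g)=\mathcal A_i(h)=:\mathcal A_i(s_i)$, and the game is guaranteed to end up in a terminal state. A policy $\pi_i$ assigns to each information state $s_i$ at which $i$ acts a distribution $\pi_i(s_i,\cdot)$ over $\mathcal A_i(s_i)$; a strategy profile is $\pi=(\pi_i)_{i\in\mathcal N}$. **CFR on $G$.** For a profile $\pi$: $v_i^\pi(h)$ is the expected future reward $\mathbb E[\mathcal R_i(\tau)]$ over trajectories $\tau$ that start at the last state of $h$, are generated from $\pi$ and $\mathcal T$, and end in a terminal state, given that the current history is $h$; $q_i^\pi(h,a_i)$ is the same except that $i$ is assumed to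 take $a_i$ at $h$. Reach probabilities: $P_c(h)=\prod_{h'aw\sqsubseteq h}\mathcal T(h',a,w)$, $P_j^\pi(h)=\prod_{h'aw\sqsubseteq h}\pi_j(s_j(h'),a_j)$ (factor $1$ for $noop$), $P_{-i}^\pi(h)=P_c(h)\prod_{j\in\mathcal N\setminus\{i\}}P_j^\pi(h)$, $P_{-i}^\pi(s_i)=\sum_{s_i(h)=s_i}P_{-i}^\pi(h)$. Values of information states are $v_i^\pi(s_i)=\sum_{s_i(h)=s_i}P^\pi(h|s_i)v_i^\pi(h)$ and $q_i^\pi(s_i,a_i)=\sum_{s_i(h)=s_i}P^\pi(h|s_i)q_i^\pi(h,a_i)$, where $P^\pi(h|s_i)=P^\pi_{-i}(h)/P^\pi_{-i}(s_i)$ is the probability that $h$ is the current history when $s_i$ is $i$'s current information state; counterfactual values are $v^\pi_{i,\mathrm{cf}}(s_i)=P^\pi_{-i}(s_i)v_i^\pi(s_i)$ and $q^\pi_{i,\mathrm{cf}}(s_i,a_i)=P^\pi_{-i}(s_i)q^\pi_i(s_i,a_i)$. CFR is self-play with regret matching at each information state: the policies $\pi^0,\pi^1,\dots$ are given by $$R_i^t(s_i,a_i)=\sum_{k=0}^{t-1}\bigl(q^{\pi^k}_{i,\mathrm{cf}}(s_i,a_i)-v^{\pi^k}_{i,\mathrm{cf}}(s_i)\bigr),\qquad \pi^t(s_i,a_i)=\frac{(R_i^t(s_i,a_i))^+}{\sum_{a'\in\mathcal A_i(s_i)}(R_i^t(s_i,a'))^+},$$ where $(x)^+=\max(x,0)$,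 and $\pi^t(s_i,a_i)=1/|\mathcal A_i(s_i)|$ when the denominator is $0$. **$\mathtt{ClassicalEFG}(G)$.** Let $G'=\mathtt{Serialize}(G)$ be the FOSG in which, at each $w$, the active players choose actions one by one. Its world states are $w_{i,a_{<i}}$ for $i\in p(w)$, $a_{<i}\in\prod_{j\in p(w),j<i}\mathcal A_j(w)$, where only $i$ acts with legal actions $\mathcal A_i(w)$, and $w_{c,a}$ for $a\in\prod_{j\in p(w)}\mathcal A_j(w)$, where nobody acts. Taking $a_i$ at $w_{i,a_{<i}}$ leads deterministically to $w_{j,a_{<i}a_i}$ for the first $j>i$ in $p(w)$, or to $w_{c,a_{<i}a_i}$ if there is none, with trivial rewards and observations. From $w_{c,a}$ the game moves to $w'$ (respectively to the corresponding $w'_{\min p(w'),\emptyset}$) with $w'\sim\mathcal T(w,a)$, generating rewards $\mathcal R(w,a)$ and observations $\mathcal O(w,a,w')$. The classical extensive-form game $E'=\mathtt{ClassicalEFG}(G)$ has the history tree of $G'$ as its game tree, the same acting players (chance $c$ where nobody acts at a non-terminal node, with probabilities given by the transition function), utilities $u_i(z)=\mathcal R_i(z)$ at terminal histories, and as information sets of $i$ the classes of histories $h$ of $G'$ at which $i$ acts and that share the same information state $s_i(h)$ in $G'$. This construction induces a mapping between the information states of $G$ at which $i$ acts and the information sets of $i$ in $E'$, via which strategies in $G$ and strategies in $E'$ are identified. **CFR on $E'$.** It is defined analogously (with information sets in place of information states), except that utilities $u_i(z)$, i.e. total cumulative rewards rather than future rewards, are used to define $v_i^\pi(h)$. *)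

theory Defs
  imports "HOL-Probability.Probability" "HOL-Library.Sublist"
begin

section \<open>Factored-observation stochastic games\<close>

text \<open>A joint action; \<^term>\<open>None\<close> is the action noop.\<close>

type_synonym 'a joint = "nat \<Rightarrow> 'a option"

abbreviation (input) noops :: "'a joint" where "noops \<equiv> \<lambda>_. None"

text \<open>
  The ambient action sets of the players are all of \<^typ>\<open>'a\<close>. The field \<open>legal\<close> only matters at
  active players, and the total functions \<open>reward\<close>, \<open>obs_priv\<close>, \<open>obs_pub\<close> only on their mathematical
  domain (non-terminal state, legal joint action, successor state in the support). The partiality
  of the transition function carries information (it determines the terminal states), whence the
  option type. Transition distributions are discrete, since reach probabilities are products of
  point probabilities.
\<close>

record ('w, 'a, 'o) fosg =
  nplayers :: nat
  states :: "'w set"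
  init :: 'w
  active :: "'w \<Rightarrow> nat set"
  legal :: "nat \<Rightarrow> 'w \<Rightarrow> 'a set"
  trans :: "'w \<Rightarrow> 'a joint \<Rightarrow> 'w pmf option"
  reward :: "'w \<Rightarrow> 'a joint \<Rightarrow> nat \<Rightarrow> real"
  obs_priv :: "nat \<Rightarrow> 'w \<Rightarrow> 'a joint \<Rightarrow> 'w \<Rightarrow> 'o"
  obs_pub :: "'w \<Rightarrow> 'a joint \<Rightarrow> 'w \<Rightarrow> 'o"

definition players :: "('w, 'a, 'o) fosg \<Rightarrow> nat set" where
  "players G = {1..nplayers G}"

definition moves :: "('w, 'a, 'o) fosg \<Rightarrow> nat \<Rightarrow> 'w \<Rightarrow> 'a option set" where
  "moves G i w = (if i \<in> active G w then Some ` legal G i w else {None})"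

definition joint_legal :: "('w, 'a, 'o) fosg \<Rightarrow> 'w \<Rightarrow> 'a joint set" where
  "joint_legal G w =
     {a. (\<forall>i\<in>players G. a i \<in> moves G i w) \<and> (\<forall>i. i \<notin> players G \<longrightarrow> a i = None)}"

definition terminal :: "('w, 'a, 'o) fosg \<Rightarrow> 'w \<Rightarrow> bool" where
  "terminal G w \<longleftrightarrow> active G w = {} \<and> trans G w noops = None"

definition trans_prob :: "('w, 'a, 'o) fosg \<Rightarrow> 'w \<Rightarrow> 'a joint \<Rightarrow> 'w \<Rightarrow> real" where
  "trans_prob G w a w' = (case trans G w a of None \<Rightarrow> 0 | Some D \<Rightarrow> pmf D w')"

text \<open>
  A history $w^0 a^0 w^1 \ldots w^t$ is represented by the list of the pairs $(a^k, w^{k+1})$; the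
  first state is always the initial one.
\<close>

type_synonym ('w, 'a) history = "('a joint \<times> 'w) list"

definition last_state :: "('w, 'a, 'o) fosg \<Rightarrow> ('w, 'a) history \<Rightarrow> 'w" where
  "last_state G h = (if h = [] then init G else snd (last h))"

inductive_set histories :: "('w, 'a, 'o) fosg \<Rightarrow> ('w, 'a) history set"
  for G :: "('w, 'a, 'o) fosg" where
  empty: "[] \<in> histories G"
| snoc: "h \<in> histories G \<Longrightarrow> a \<in> joint_legal G (last_state G h) \<Longrightarrow>
    trans G (last_state G h) a = Some D \<Longrightarrow> w \<in> set_pmf D \<Longrightarrow> h @ [(a, w)] \<in> histories G"

definition terminal_histories :: "('w, 'a, 'o) fosg \<Rightarrow> ('w, 'a) history set" where
  "terminal_histories G = {z \<in> histories G. terminal G (last_state G z)}"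

text \<open>The state, joint action and successor state of the transition number \<open>k\<close> along \<open>h\<close>.\<close>

definition pre_state :: "('w, 'a, 'o) fosg \<Rightarrow> ('w, 'a) history \<Rightarrow> nat \<Rightarrow> 'w" where
  "pre_state G h k = last_state G (take k h)"

abbreviation act_at :: "('w, 'a) history \<Rightarrow> nat \<Rightarrow> 'a joint" where
  "act_at h k \<equiv> fst (h ! k)"

abbreviation post_state :: "('w, 'a) history \<Rightarrow> nat \<Rightarrow> 'w" where
  "post_state h k \<equiv> snd (h ! k)"

text \<open>
  Here and for the reach probabilities below, the argument \<open>m\<close> is the number of initial transitions
  to be ignored: \<open>m = 0\<close> gives the quantity for the whole history \<open>h\<close>, and \<open>m\<close> equal to the length
  of a prefix of \<open>h\<close> gives that of the trajectory continuing the prefix.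
\<close>

definition reward_from :: "('w, 'a, 'o) fosg \<Rightarrow> nat \<Rightarrow> nat \<Rightarrow> ('w, 'a) history \<Rightarrow> real" where
  "reward_from G i m h = (\<Sum>k\<in>{m..<length h}. reward G (pre_state G h k) (act_at h k) i)"

abbreviation cum_reward :: "('w, 'a, 'o) fosg \<Rightarrow> nat \<Rightarrow> ('w, 'a) history \<Rightarrow> real" where
  "cum_reward G i h \<equiv> reward_from G i 0 h"

datatype ('a, 'o) entry = Act 'a | Obs (priv: 'o) (pub: 'o)

definition info_state ::
    "('w, 'a, 'o) fosg \<Rightarrow> nat \<Rightarrow> ('w, 'a) history \<Rightarrow> ('a, 'o) entry list" where
  "info_state G i h = concat (map (\<lambda>k.
     (case act_at h k i of None \<Rightarrow> [] | Some x \<Rightarrow> [Act x]) @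
     [Obs (obs_priv G i (pre_state G h k) (act_at h k) (post_state h k))
          (obs_pub G (pre_state G h k) (act_at h k) (post_state h k))]) [0..<length h])"

definition acts_in :: "('w, 'a, 'o) fosg \<Rightarrow> nat \<Rightarrow> ('w, 'a) history set" where
  "acts_in G i = {h \<in> histories G. i \<in> active G (last_state G h)}"

definition acting_info_states ::
    "('w, 'a, 'o) fosg \<Rightarrow> nat \<Rightarrow> ('a, 'o) entry list set" where
  "acting_info_states G i =
     info_state G i ` acts_in G i"

definition legal_at ::
    "('w, 'a, 'o) fosg \<Rightarrow> nat \<Rightarrow> ('a, 'o) entry list \<Rightarrow> 'a set" where
  "legal_at G i s =
     {x. \<exists>h\<in>histories G. info_state G i h = s \<and> Some x \<in> moves G i (last_state G h)}"

text \<open>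
  Strategy profiles map a player, an information state (information set, for extensive-form games)
  and an action to a probability.
\<close>

type_synonym ('a, 's) profile = "nat \<Rightarrow> 's \<Rightarrow> 'a \<Rightarrow> real"

definition is_profile ::
    "('w, 'a, 'o) fosg \<Rightarrow> ('a, ('a, 'o) entry list) profile \<Rightarrow> bool" where
  "is_profile G \<pi> \<longleftrightarrow> (\<forall>i\<in>players G. \<forall>s\<in>acting_info_states G i.
     (\<forall>x\<in>legal_at G i s. 0 \<le> \<pi> i s x) \<and> (\<pi> i s has_sum 1) (legal_at G i s))"

definition chance_reach :: "('w, 'a, 'o) fosg \<Rightarrow> nat \<Rightarrow> ('w, 'a) history \<Rightarrow> real" where
  "chance_reach G m h =
     (\<Prod>k\<in>{m..<length h}. trans_prob G (pre_state G h k) (act_at h k) (post_state h k))"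

definition player_reach ::
    "('w, 'a, 'o) fosg \<Rightarrow> ('a, ('a, 'o) entry list) profile \<Rightarrow> nat \<Rightarrow> nat \<Rightarrow> ('w, 'a) history \<Rightarrow> real"
  where
  "player_reach G \<pi> j m h = (\<Prod>k\<in>{m..<length h}.
     (case act_at h k j of None \<Rightarrow> 1 | Some x \<Rightarrow> \<pi> j (info_state G j (take k h)) x))"

definition others_reach ::
    "('w, 'a, 'o) fosg \<Rightarrow> ('a, ('a, 'o) entry list) profile \<Rightarrow> nat \<Rightarrow> nat \<Rightarrow> ('w, 'a) history \<Rightarrow> real"
  where
  "others_reach G \<pi> i m h =
     chance_reach G m h * (\<Prod>j\<in>players G - {i}. player_reach G \<pi> j m h)"

definition reach ::
    "('w, 'a, 'o) fosg \<Rightarrow> ('a, ('a, 'o) entry list) profile \<Rightarrow> nat \<Rightarrow> ('w, 'a) history \<Rightarrow> real"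
  where
  "reach G \<pi> m h = chance_reach G m h * (\<Prod>j\<in>players G. player_reach G \<pi> j m h)"

text \<open>
  The assumption \<open>ends\<close> says that the game is guaranteed to end: from every history, under every
  profile, a terminal state is reached with probability one. This holds in particular when there
  is no infinite play.
\<close>

locale FOSG =
  fixes G :: "('w::topological_space, 'a::topological_space, 'o) fosg"
  assumes compact_states: "compact (states G)"
    and init_state: "init G \<in> states G"
    and active_players: "w \<in> states G \<Longrightarrow> active G w \<subseteq> players G"
    and active_init: "active G (init G) = {}"
    and legal_nonempty: "w \<in> states G \<Longrightarrow> i \<in> active G w \<Longrightarrow> legal G i w \<noteq> {}"
    and legal_compact: "w \<in> states G \<Longrightarrow> i \<in> active G w \<Longrightarrow> compact (legal G i w)"
    and trans_defined:
      "w \<in> states G \<Longrightarrow> active G w \<noteq> {} \<Longrightarrow> a \<in> joint_legal G w \<Longrightarrow> trans G w a \<noteq> None"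
    and trans_states:
      "w \<in> states G \<Longrightarrow> a \<in> joint_legal G w \<Longrightarrow> trans G w a = Some D \<Longrightarrow> set_pmf D \<subseteq> states G"
    and info_state_moves:
      "i \<in> players G \<Longrightarrow> g \<in> histories G \<Longrightarrow> h \<in> histories G \<Longrightarrow>
       info_state G i g = info_state G i h \<Longrightarrow>
       moves G i (last_state G g) = moves G i (last_state G h)"
    and ends:
      "is_profile G \<pi> \<Longrightarrow> h \<in> histories G \<Longrightarrow>
       ((\<lambda>z. reach G \<pi> (length h) z) has_sum 1) {z \<in> terminal_histories G. prefix h z}"

definition observable_rewards :: "('w, 'a, 'o) fosg \<Rightarrow> bool" where
  "observable_rewards G \<longleftrightarrow> (\<forall>i\<in>players G. \<forall>h\<in>histories G. \<forall>h'\<in>histories G.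
     info_state G i h = info_state G i h' \<longrightarrow> cum_reward G i h = cum_reward G i h')"

text \<open>Implicit in running CFR: uniform policies and finite sums over legal actions.\<close>

definition finite_actions :: "('w, 'a, 'o) fosg \<Rightarrow> bool" where
  "finite_actions G \<longleftrightarrow> (\<forall>w\<in>states G. \<forall>i\<in>active G w. finite (legal G i w))"

text \<open>
  Implicit in the definition of the values as expectations: the cumulative rewards are integrable
  under every profile (automatic if, for instance, they are bounded). For real functions,
  \<^const>\<open>summable_on\<close> is absolute summability.
\<close>

definition integrable_rewards :: "('w, 'a, 'o) fosg \<Rightarrow> bool" where
  "integrable_rewards G \<longleftrightarrow> (\<forall>\<pi>. is_profile G \<pi> \<longrightarrow> (\<forall>i\<in>players G.
     (\<lambda>z. reach G \<pi> 0 z * cum_reward G i z) summable_on terminal_histories G))"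


section \<open>Counterfactual regret minimization on a FOSG\<close>

text \<open>\<open>A\<close> is the set of legal actions and \<open>R\<close> the vector of cumulative regrets.\<close>

definition regret_matching :: "'a set \<Rightarrow> ('a \<Rightarrow> real) \<Rightarrow> 'a \<Rightarrow> real" where
  "regret_matching A R x =
     (if x \<notin> A then 0
      else if (\<Sum>y\<in>A. max (R y) 0) = 0 then 1 / real (card A)
      else max (R x) 0 / (\<Sum>y\<in>A. max (R y) 0))"

definition value_hist ::
    "('w, 'a, 'o) fosg \<Rightarrow> ('a, ('a, 'o) entry list) profile \<Rightarrow> nat \<Rightarrow> ('w, 'a) history \<Rightarrow> real" where
  "value_hist G \<pi> i h =
     (\<Sum>\<^sub>\<infinity>z\<in>{z \<in> terminal_histories G. prefix h z}.
        reach G \<pi> (length h) z * reward_from G i (length h) z)"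

text \<open>
  In \<open>q_hist\<close>, only the trajectories on which player \<open>i\<close> starts with \<open>x\<close> count, and the factor of
  player \<open>i\<close> for that first action is replaced by 1.
\<close>

definition q_hist ::
    "('w, 'a, 'o) fosg \<Rightarrow> ('a, ('a, 'o) entry list) profile \<Rightarrow> nat \<Rightarrow> ('w, 'a) history \<Rightarrow> 'a \<Rightarrow> real"
  where
  "q_hist G \<pi> i h x =
     (\<Sum>\<^sub>\<infinity>z\<in>{z \<in> terminal_histories G. strict_prefix h z \<and> act_at z (length h) i = Some x}.
        others_reach G \<pi> i (length h) z * player_reach G \<pi> i (Suc (length h)) z *
        reward_from G i (length h) z)"

definition info_histories ::
    "('w, 'a, 'o) fosg \<Rightarrow> nat \<Rightarrow> ('a, 'o) entry list \<Rightarrow> ('w, 'a) history set" where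
  "info_histories G i s = {h \<in> histories G. info_state G i h = s}"

definition others_reach_info ::
    "('w, 'a, 'o) fosg \<Rightarrow> ('a, ('a, 'o) entry list) profile \<Rightarrow> nat \<Rightarrow> ('a, 'o) entry list \<Rightarrow> real"
  where
  "others_reach_info G \<pi> i s = (\<Sum>\<^sub>\<infinity>h\<in>info_histories G i s. others_reach G \<pi> i 0 h)"

definition belief ::
    "('w, 'a, 'o) fosg \<Rightarrow> ('a, ('a, 'o) entry list) profile \<Rightarrow> nat \<Rightarrow> ('a, 'o) entry list \<Rightarrow>
     ('w, 'a) history \<Rightarrow> real" where
  "belief G \<pi> i s h = others_reach G \<pi> i 0 h / others_reach_info G \<pi> i s"

definition value_info ::
    "('w, 'a, 'o) fosg \<Rightarrow> ('a, ('a, 'o) entry list) profile \<Rightarrow> nat \<Rightarrow> ('a, 'o) entry list \<Rightarrow> real"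
  where
  "value_info G \<pi> i s = (\<Sum>\<^sub>\<infinity>h\<in>info_histories G i s. belief G \<pi> i s h * value_hist G \<pi> i h)"

definition q_info ::
    "('w, 'a, 'o) fosg \<Rightarrow> ('a, ('a, 'o) entry list) profile \<Rightarrow> nat \<Rightarrow> ('a, 'o) entry list \<Rightarrow>
     'a \<Rightarrow> real" where
  "q_info G \<pi> i s x = (\<Sum>\<^sub>\<infinity>h\<in>info_histories G i s. belief G \<pi> i s h * q_hist G \<pi> i h x)"

definition value_cf ::
    "('w, 'a, 'o) fosg \<Rightarrow> ('a, ('a, 'o) entry list) profile \<Rightarrow> nat \<Rightarrow> ('a, 'o) entry list \<Rightarrow> real"
  where
  "value_cf G \<pi> i s = others_reach_info G \<pi> i s * value_info G \<pi> i s"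

definition q_cf ::
    "('w, 'a, 'o) fosg \<Rightarrow> ('a, ('a, 'o) entry list) profile \<Rightarrow> nat \<Rightarrow> ('a, 'o) entry list \<Rightarrow>
     'a \<Rightarrow> real" where
  "q_cf G \<pi> i s x = others_reach_info G \<pi> i s * q_info G \<pi> i s x"

context
  notes sum.cong [fundef_cong]
begin

fun cfr :: "('w, 'a, 'o) fosg \<Rightarrow> nat \<Rightarrow> ('a, ('a, 'o) entry list) profile" where
  "cfr G t = (\<lambda>i s. regret_matching (legal_at G i s)
     (\<lambda>x. \<Sum>k<t. q_cf G (cfr G k) i s x - value_cf G (cfr G k) i s))"

end

declare cfr.simps [simp del]


section \<open>Extensive-form games and CFR on them\<close>

text \<open>
  Nodes are sequences of edges. \<open>actor\<close> is \<^term>\<open>None\<close> at chance nodes and terminal nodes,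
  \<open>chance_prob\<close> is the probability of an edge at a chance node, and \<open>edge_action\<close> is the action of the
  acting player to which an edge at one of his nodes corresponds; this is what identifies edges
  at different nodes of an information set.
\<close>

record ('e, 'a) efg =
  efg_players :: "nat set"
  tree :: "'e list set"
  leaves :: "'e list set"
  actor :: "'e list \<Rightarrow> nat option"
  chance_prob :: "'e list \<Rightarrow> 'e \<Rightarrow> real"
  edge_action :: "'e list \<Rightarrow> 'e \<Rightarrow> 'a"
  utility :: "nat \<Rightarrow> 'e list \<Rightarrow> real"
  infosets :: "nat \<Rightarrow> 'e list set set"

definition infoset_of :: "('e, 'a) efg \<Rightarrow> nat \<Rightarrow> 'e list \<Rightarrow> 'e list set" where
  "infoset_of E i h = (THE I. I \<in> infosets E i \<and> h \<in> I)"

definition efg_legal :: "('e, 'a) efg \<Rightarrow> 'e list set \<Rightarrow> 'a set" where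
  "efg_legal E I = {edge_action E h e |h e. h \<in> I \<and> h @ [e] \<in> tree E}"

text \<open>As above, \<open>m\<close> is the number of initial edges to be ignored.\<close>

definition efg_chance_reach :: "('e, 'a) efg \<Rightarrow> nat \<Rightarrow> 'e list \<Rightarrow> real" where
  "efg_chance_reach E m h =
     (\<Prod>k\<in>{k\<in>{m..<length h}. actor E (take k h) = None}. chance_prob E (take k h) (h ! k))"

definition efg_player_reach ::
    "('e, 'a) efg \<Rightarrow> ('a, 'e list set) profile \<Rightarrow> nat \<Rightarrow> nat \<Rightarrow> 'e list \<Rightarrow> real" where
  "efg_player_reach E \<sigma> j m h =
     (\<Prod>k\<in>{k\<in>{m..<length h}. actor E (take k h) = Some j}.
        \<sigma> j (infoset_of E j (take k h)) (edge_action E (take k h) (h ! k)))"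

definition efg_others_reach ::
    "('e, 'a) efg \<Rightarrow> ('a, 'e list set) profile \<Rightarrow> nat \<Rightarrow> nat \<Rightarrow> 'e list \<Rightarrow> real" where
  "efg_others_reach E \<sigma> i m h =
     efg_chance_reach E m h * (\<Prod>j\<in>efg_players E - {i}. efg_player_reach E \<sigma> j m h)"

definition efg_reach ::
    "('e, 'a) efg \<Rightarrow> ('a, 'e list set) profile \<Rightarrow> nat \<Rightarrow> 'e list \<Rightarrow> real" where
  "efg_reach E \<sigma> m h =
     efg_chance_reach E m h * (\<Prod>j\<in>efg_players E. efg_player_reach E \<sigma> j m h)"

definition efg_value_hist ::
    "('e, 'a) efg \<Rightarrow> ('a, 'e list set) profile \<Rightarrow> nat \<Rightarrow> 'e list \<Rightarrow> real" where
  "efg_value_hist E \<sigma> i h =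
     (\<Sum>\<^sub>\<infinity>z\<in>{z \<in> leaves E. prefix h z}. efg_reach E \<sigma> (length h) z * utility E i z)"

definition efg_q_hist ::
    "('e, 'a) efg \<Rightarrow> ('a, 'e list set) profile \<Rightarrow> nat \<Rightarrow> 'e list \<Rightarrow> 'a \<Rightarrow> real" where
  "efg_q_hist E \<sigma> i h x =
     (\<Sum>\<^sub>\<infinity>z\<in>{z \<in> leaves E. strict_prefix h z \<and> edge_action E h (z ! length h) = x}.
        efg_others_reach E \<sigma> i (length h) z * efg_player_reach E \<sigma> i (Suc (length h)) z *
        utility E i z)"

definition efg_others_reach_info ::
    "('e, 'a) efg \<Rightarrow> ('a, 'e list set) profile \<Rightarrow> nat \<Rightarrow> 'e list set \<Rightarrow> real" where
  "efg_others_reach_info E \<sigma> i I = (\<Sum>\<^sub>\<infinity>h\<in>I. efg_others_reach E \<sigma> i 0 h)"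

definition efg_belief ::
    "('e, 'a) efg \<Rightarrow> ('a, 'e list set) profile \<Rightarrow> nat \<Rightarrow> 'e list set \<Rightarrow> 'e list \<Rightarrow> real" where
  "efg_belief E \<sigma> i I h = efg_others_reach E \<sigma> i 0 h / efg_others_reach_info E \<sigma> i I"

definition efg_value_info ::
    "('e, 'a) efg \<Rightarrow> ('a, 'e list set) profile \<Rightarrow> nat \<Rightarrow> 'e list set \<Rightarrow> real" where
  "efg_value_info E \<sigma> i I = (\<Sum>\<^sub>\<infinity>h\<in>I. efg_belief E \<sigma> i I h * efg_value_hist E \<sigma> i h)"

definition efg_q_info ::
    "('e, 'a) efg \<Rightarrow> ('a, 'e list set) profile \<Rightarrow> nat \<Rightarrow> 'e list set \<Rightarrow> 'a \<Rightarrow> real" where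
  "efg_q_info E \<sigma> i I x = (\<Sum>\<^sub>\<infinity>h\<in>I. efg_belief E \<sigma> i I h * efg_q_hist E \<sigma> i h x)"

definition efg_value_cf ::
    "('e, 'a) efg \<Rightarrow> ('a, 'e list set) profile \<Rightarrow> nat \<Rightarrow> 'e list set \<Rightarrow> real" where
  "efg_value_cf E \<sigma> i I = efg_others_reach_info E \<sigma> i I * efg_value_info E \<sigma> i I"

definition efg_q_cf ::
    "('e, 'a) efg \<Rightarrow> ('a, 'e list set) profile \<Rightarrow> nat \<Rightarrow> 'e list set \<Rightarrow> 'a \<Rightarrow> real" where
  "efg_q_cf E \<sigma> i I x = efg_others_reach_info E \<sigma> i I * efg_q_info E \<sigma> i I x"

context
  notes sum.cong [fundef_cong]
begin

fun efg_cfr :: "('e, 'a) efg \<Rightarrow> nat \<Rightarrow> ('a, 'e list set) profile" where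
  "efg_cfr E t = (\<lambda>i I. regret_matching (efg_legal E I)
     (\<lambda>x. \<Sum>k<t. efg_q_cf E (efg_cfr E k) i I x - efg_value_cf E (efg_cfr E k) i I))"

end

declare efg_cfr.simps [simp del]


section \<open>Serialization and the classical extensive-form game of a FOSG\<close>

text \<open>
  \<open>Decide w i b\<close> is the state $w_{i,b}$ and \<open>Resolve w a\<close> is the state $w_{c,a}$. Partial joint
  actions are \<^term>\<open>None\<close> outside their domain.
\<close>

datatype ('w, 'a) sstate =
    Decide (base: 'w) nat "'a joint"
  | Resolve (base: 'w) "'a joint"

definition partial_legal :: "('w, 'a, 'o) fosg \<Rightarrow> 'w \<Rightarrow> nat \<Rightarrow> 'a joint set" where
  "partial_legal G w i =
     {b. (\<forall>j\<in>active G w. j < i \<longrightarrow> b j \<in> Some ` legal G j w) \<and>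
         (\<forall>j. \<not> (j \<in> active G w \<and> j < i) \<longrightarrow> b j = None)}"

definition entry_state :: "('w, 'a, 'o) fosg \<Rightarrow> 'w \<Rightarrow> ('w, 'a) sstate" where
  "entry_state G w =
     (if active G w = {} then Resolve w noops else Decide w (Min (active G w)) noops)"

definition next_state :: "('w, 'a, 'o) fosg \<Rightarrow> 'w \<Rightarrow> nat \<Rightarrow> 'a joint \<Rightarrow> ('w, 'a) sstate" where
  "next_state G w i b =
     (if \<exists>j\<in>active G w. i < j then Decide w (Min {j \<in> active G w. i < j}) b else Resolve w b)"

text \<open>In the serialized game, the observation \<^term>\<open>None\<close> is the trivial one.\<close>

definition serialize ::
    "('w, 'a, 'o) fosg \<Rightarrow> (('w, 'a) sstate, 'a, 'o option) fosg" where
  "serialize G =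
     \<lparr> nplayers = nplayers G,
       states = {Decide w i b |w i b. w \<in> states G \<and> i \<in> active G w \<and> b \<in> partial_legal G w i} \<union>
                {Resolve w a |w a. w \<in> states G \<and> a \<in> joint_legal G w},
       init = entry_state G (init G),
       active = (\<lambda>u. case u of Decide w i b \<Rightarrow> {i} | Resolve w a \<Rightarrow> {}),
       legal = (\<lambda>i u. legal G i (base u)),
       trans = (\<lambda>u d. case u of
           Decide w i b \<Rightarrow> Some (return_pmf (next_state G w i (b(i := d i))))
         | Resolve w a \<Rightarrow> map_option (map_pmf (entry_state G)) (trans G w a)),
       reward = (\<lambda>u d i. case u of Decide w j b \<Rightarrow> 0 | Resolve w a \<Rightarrow> reward G w a i),
       obs_priv = (\<lambda>i u d u'. case u of
           Decide w j b \<Rightarrow> None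
         | Resolve w a \<Rightarrow> Some (obs_priv G i w a (base u'))),
       obs_pub = (\<lambda>u d u'. case u of
           Decide w j b \<Rightarrow> None
         | Resolve w a \<Rightarrow> Some (obs_pub G w a (base u'))) \<rparr>"

text \<open>
  Trivial observations leave no trace in the information states of the serialized game; otherwise
  the number of active players who choose before player \<open>i\<close> would leak into the information sets
  of \<open>i\<close>, and information states of the original game would not correspond to information sets.
\<close>

definition serial_info_state ::
    "('w, 'a, 'o) fosg \<Rightarrow> nat \<Rightarrow> (('w, 'a) sstate, 'a) history \<Rightarrow> ('a, 'o option) entry list" where
  "serial_info_state G i g = filter (\<lambda>e. e \<noteq> Obs None None) (info_state (serialize G) i g)"

definition classical_efg ::
    "('w, 'a, 'o) fosg \<Rightarrow> ('a joint \<times> ('w, 'a) sstate, 'a) efg" where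
  "classical_efg G = (let G' = serialize G in
     \<lparr> efg_players = players G',
       tree = histories G',
       leaves = terminal_histories G',
       actor = (\<lambda>g. if active G' (last_state G' g) = {} then None
                    else Some (the_elem (active G' (last_state G' g)))),
       chance_prob = (\<lambda>g e. trans_prob G' (last_state G' g) (fst e) (snd e)),
       edge_action = (\<lambda>g e. the (fst e (the_elem (active G' (last_state G' g))))),
       utility = (\<lambda>i z. cum_reward G' i z),
       infosets = (\<lambda>i. {{g' \<in> acts_in G' i. serial_info_state G i g' = serial_info_state G i g} |g.
                         g \<in> acts_in G' i}) \<rparr>)"

text \<open>
  Every history of the serialized game arises from a history of the original game, followed by the
  choices of some of the active players at its last state. The former is recovered by keeping the
  transitions out of the states \<open>Resolve w a\<close> only.
\<close>

definition unserialize ::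
    "('w, 'a, 'o) fosg \<Rightarrow> (('w, 'a) sstate, 'a) history \<Rightarrow> ('w, 'a) history" where
  "unserialize G g = concat (map (\<lambda>k. case pre_state (serialize G) g k of
       Decide w i b \<Rightarrow> []
     | Resolve w a \<Rightarrow> [(a, base (post_state g k))]) [0..<length g])"

definition infoset_map ::
    "('w, 'a, 'o) fosg \<Rightarrow> nat \<Rightarrow> ('a, 'o) entry list \<Rightarrow> (('w, 'a) sstate, 'a) history set" where
  "infoset_map G i s = {g \<in> acts_in (serialize G) i. info_state G i (unserialize G g) = s}"

end

(*
  Force player i to play along an information state s (possibly followed by an action x), and let
  W z be the probability of the terminal history z under the resulting profile. By perfect recall,
  W z = P_{-i}(h) * P(h -> z) for every history h in s, so both counterfactual values v(s) and
  q(s, x) are sums of W z times the future reward over the z passing through s. The serialized game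
  has the same terminal histories with the same W, and CFR on it uses the cumulative reward instead.
  As cumulative rewards are constant on s, the two versions of v(s) differ by that constant times
  the total W-mass, which is P_{-i}(s); so do the two versions of q(s, x), and regrets agree.
*)
theory Submission
  imports Defs
begin

text \<open>The weights W cannot be taken under \<open>\<pi>\<close> itself. Player i's own policy
  may reach s with probability 0, and then the play under \<open>\<pi>\<close> says nothing about
  the sums behind the counterfactual values, whereas \<open>ends\<close> and
  \<open>integrable_rewards\<close> speak only of play under profiles. \<open>follow\<close> yields
  genuine profiles under which i does its part to reach s, and the interchanges of infinite sums
  over terminal histories are justified by applying the two assumptions to these. Nodes of the two
  games do not match: a history in s becomes one node for each combination of choices of the active
  players with a smaller number than i. Terminal histories do match, which is why values are
  compared only after being rewritten as sums over terminal histories. The reach of whole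
  information sets is still compared over nodes, but only to know that the normalisation of beliefs
  cancels in both games; where it is 0, all counterfactual values vanish because of the factor in
  front of them.\<close>

lemma
  fixes f :: "'b \<Rightarrow> real"
  assumes disj: "disjoint_family_on B A" and summ: "f summable_on (\<Union>x\<in>A. B x)"
  shows summable_on_disjoint_Union: "(\<lambda>x. \<Sum>\<^sub>\<infinity>y\<in>B x. f y) summable_on A"
    and infsum_disjoint_Union: "(\<Sum>\<^sub>\<infinity>x\<in>A. \<Sum>\<^sub>\<infinity>y\<in>B x. f y) = infsum f (\<Union>x\<in>A. B x)"
proof -
  \<comment> \<open>Disjointness is what makes \<open>snd\<close> injective, so the summation
    theorems for \<open>Sigma\<close> carry over to the union.\<close>
  have inj: "inj_on snd (Sigma A B)"
    using disj by (auto simp: inj_on_def disjoint_family_on_def)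
  have img: "snd ` Sigma A B = (\<Union>x\<in>A. B x)" by force
  have s: "(f \<circ> snd) summable_on Sigma A B"
    using summ summable_on_reindex[OF inj, of f] by (simp add: img)
  have "(\<lambda>x. infsum (\<lambda>y. (f \<circ> snd) (x, y)) (B x)) summable_on A"
    by (rule summable_on_Sigma_banach) (use s in \<open>simp add: case_prod_unfold comp_def\<close>)
  then show "(\<lambda>x. \<Sum>\<^sub>\<infinity>y\<in>B x. f y) summable_on A" by simp
  show "(\<Sum>\<^sub>\<infinity>x\<in>A. \<Sum>\<^sub>\<infinity>y\<in>B x. f y) = infsum f (\<Union>x\<in>A. B x)"
    using infsum_Sigma_banach[OF s] infsum_reindex[OF inj, of f] by (simp add: img)
qed

section \<open>Histories and information states\<close>

lemma last_state_Nil [simp]: "last_state G [] = init G"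
  by (simp add: last_state_def)

lemma last_state_snoc [simp]: "last_state G (h @ [e]) = snd e"
  by (simp add: last_state_def)

lemma pre_state_append [simp]: "k < length h \<Longrightarrow> pre_state G (h @ r) k = pre_state G h k"
  by (simp add: pre_state_def)

lemma pre_state_append_length [simp]: "pre_state G (h @ r) (length h) = last_state G h"
  by (simp add: pre_state_def)

lemma histories_snocD:
  assumes "h @ [e] \<in> histories G"
  obtains D where "h \<in> histories G" "fst e \<in> joint_legal G (last_state G h)"
    "trans G (last_state G h) (fst e) = Some D" "snd e \<in> set_pmf D"
  using assms by (cases rule: histories.cases) auto

lemma histories_appendD: "h @ r \<in> histories G \<Longrightarrow> h \<in> histories G"
proof (induction r rule: rev_induct)
  case (snoc e r)
  then show ?case by (metis append_assoc histories_snocD)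
qed simp

lemma histories_take: "h \<in> histories G \<Longrightarrow> take k h \<in> histories G"
  by (metis append_take_drop_id histories_appendD)

lemma reward_from_Nil [simp]: "reward_from G i m [] = 0"
  by (simp add: reward_from_def)

lemma cum_reward_snoc [simp]:
  "cum_reward G i (h @ [e]) = cum_reward G i h + reward G (last_state G h) (fst e) i"
  by (simp add: reward_from_def nth_append)

lemma cum_reward_append: "cum_reward G i (h @ r) = cum_reward G i h + reward_from G i (length h) (h @ r)"
proof -
  have "cum_reward G i (h @ r) =
      (\<Sum>k\<in>{0..<length h}. reward G (pre_state G (h @ r) k) (act_at (h @ r) k) i)
      + reward_from G i (length h) (h @ r)"
    unfolding reward_from_def by (subst sum.atLeastLessThan_concat) auto
  also have "(\<Sum>k\<in>{0..<length h}. reward G (pre_state G (h @ r) k) (act_at (h @ r) k) i) =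
      cum_reward G i h"
    unfolding reward_from_def by (intro sum.cong) (auto simp: nth_append)
  finally show ?thesis .
qed

definition info_step ::
    "('w, 'a, 'o) fosg \<Rightarrow> nat \<Rightarrow> 'w \<Rightarrow> 'a joint \<times> 'w \<Rightarrow> ('a, 'o) entry list" where
  "info_step G i w e = (case fst e i of None \<Rightarrow> [] | Some x \<Rightarrow> [Act x]) @
     [Obs (obs_priv G i w (fst e) (snd e)) (obs_pub G w (fst e) (snd e))]"

lemma info_step_not_Nil [simp]: "info_step G i w e \<noteq> []"
  by (simp add: info_step_def)

text \<open>A step is either a single \<open>Obs\<close> or an \<open>Act\<close> followed by an
  \<open>Obs\<close>, so its first entry fixes its length.\<close>

lemma info_step_prefix_free:
  "info_step G i w e @ s = info_step G' i' w' e' @ s' \<Longrightarrow>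
   info_step G i w e = info_step G' i' w' e' \<and> s = s'"
  by (auto simp: info_step_def split: option.splits)

lemma info_state_Nil [simp]: "info_state G i [] = []"
  by (simp add: info_state_def)

lemma info_state_snoc [simp]:
  "info_state G i (h @ [e]) = info_state G i h @ info_step G i (last_state G h) e"
proof -
  have "info_state G i (h @ [e]) =
      concat (map (\<lambda>k. info_step G i (pre_state G (h @ [e]) k) ((h @ [e]) ! k)) [0..<length h])
      @ info_step G i (last_state G h) e"
    by (simp add: info_state_def info_step_def)
  also have "map (\<lambda>k. info_step G i (pre_state G (h @ [e]) k) ((h @ [e]) ! k)) [0..<length h] =
      map (\<lambda>k. info_step G i (pre_state G h k) (h ! k)) [0..<length h]"
    by (intro map_cong) (auto simp: nth_append)
  finally show ?thesis by (simp add: info_state_def info_step_def)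
qed

text \<open>The equivalence records that every transition appends at least an observation:
  information states grow strictly along a history.\<close>

lemma info_state_append:
  obtains t where "info_state G i (h @ r) = info_state G i h @ t" "t = [] \<longleftrightarrow> r = []"
proof -
  have "\<exists>t. info_state G i (h @ r) = info_state G i h @ t \<and> (t = [] \<longleftrightarrow> r = [])"
  proof (induction r rule: rev_induct)
    case (snoc e r)
    then show ?case by (auto simp flip: append_assoc) simp
  qed simp
  then show ?thesis using that by blast
qed

text \<open>Prefixes of z are comparable, and strict growth excludes a proper prefix with the same
  information state. Hence the sets of terminal histories above the different histories of one
  information state are disjoint.\<close>

lemma prefix_info_state_eq:
  assumes "prefix h z" "prefix h' z" "info_state G i h = info_state G i h'"
  shows "h = h'"
proof -
  have "g = g @ r" if "info_state G i g = info_state G i (g @ r)" for g r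
    using that by (metis info_state_append append_self_conv append_Nil2)
  then show ?thesis
    using assms by (metis prefix_same_cases prefixE)
qed

text \<open>Perfect recall in the form that \<open>follow\<close> tests for: an own action stands
  directly behind the information state at which it was taken.\<close>

lemma info_state_take_Act:
  assumes "k < length h" "act_at h k i = Some x"
  obtains r where "info_state G i h = info_state G i (take k h) @ Act x # r"
proof -
  have h: "h = (take k h @ [h ! k]) @ drop (Suc k) h"
    using assms by (simp add: id_take_nth_drop)
  obtain t where "info_state G i h = info_state G i (take k h @ [h ! k]) @ t"
    by (metis h info_state_append)
  then show ?thesis
    using assms that by (simp add: info_step_def)
qed

text \<open>An observation closes each step, so the steps form a prefix code.\<close>

lemma info_state_split:
  assumes "info_state G i g @ t = info_state G i h"
  obtains h1 h2 where "h = h1 @ h2" "info_state G i h1 = info_state G i g"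
proof -
  have "\<exists>h1 h2. h = h1 @ h2 \<and> info_state G i h1 = info_state G i g"
    using assms
  proof (induction g arbitrary: t rule: rev_induct)
    case Nil
    then show ?case by (intro exI[of _ "[]"] exI[of _ h]) simp
  next
    case (snoc e g)
    from snoc.prems have eq: "info_state G i g @ info_step G i (last_state G g) e @ t = info_state G i h"
      by simp
    from snoc.IH[OF this] obtain h1 h2 where h: "h = h1 @ h2" "info_state G i h1 = info_state G i g"
      by blast
    have "h2 \<noteq> []" using eq h by auto
    then obtain e2 h3 where h2: "h2 = e2 # h3" by (cases h2) auto
    obtain t2 where "info_state G i h = info_state G i (h1 @ [e2]) @ t2"
      by (metis h(1) h2 info_state_append append_Cons append_Nil append_assoc)
    with eq h(2) have "info_step G i (last_state G g) e @ t = info_step G i (last_state G h1) e2 @ t2"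
      by (simp flip: append_assoc) (metis append_assoc append_same_eq same_append_eq)
    from info_step_prefix_free[OF this] h(2)
    have "info_state G i (h1 @ [e2]) = info_state G i (g @ [e])" by simp
    then show ?case using h(1) h2 by (metis append_Cons append_Nil append_assoc)
  qed
  then show ?thesis using that by blast
qed

text \<open>Behind the part of h that accounts for the information state of g, the next step has to
  begin with \<open>Act x\<close>. This traces an entry back to a transition, where its legality can
  be read off.\<close>

lemma info_state_Act_split:
  assumes "info_state G i h = info_state G i g @ Act x # r"
  obtains h1 e h2 where "h = h1 @ e # h2" "info_state G i h1 = info_state G i g" "fst e i = Some x"
proof -
  from info_state_split[of G i g "Act x # r" h] assms
  obtain h1 h2 where h: "h = h1 @ h2" "info_state G i h1 = info_state G i g" by auto
  with assms have "h2 \<noteq> []" by auto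
  then obtain e h3 where h2: "h2 = e # h3" by (cases h2) auto
  obtain t where "info_state G i h = info_state G i (h1 @ [e]) @ t"
    by (metis h(1) h2 info_state_append append_Cons append_Nil append_assoc)
  with assms h(2) have "Act x # r = info_step G i (last_state G h1) e @ t" by simp
  then have "fst e i = Some x" by (auto simp: info_step_def split: option.splits)
  with h h2 that show ?thesis by blast
qed

section \<open>Reach probabilities\<close>

lemma chance_reach_Nil [simp]: "chance_reach G m [] = 1"
  by (simp add: chance_reach_def)

lemma chance_reach_snoc [simp]:
  "chance_reach G 0 (h @ [e]) = chance_reach G 0 h * trans_prob G (last_state G h) (fst e) (snd e)"
  by (simp add: chance_reach_def nth_append)

lemma player_reach_Nil [simp]: "player_reach G \<pi> j m [] = 1"
  by (simp add: player_reach_def)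

lemma player_reach_snoc [simp]:
  "player_reach G \<pi> j 0 (h @ [e]) = player_reach G \<pi> j 0 h *
     (case fst e j of None \<Rightarrow> 1 | Some x \<Rightarrow> \<pi> j (info_state G j h) x)"
  unfolding player_reach_def
  by (auto simp: nth_append intro!: arg_cong2[where f = times] prod.cong split: option.split)

lemma chance_reach_append:
  "chance_reach G 0 (h @ r) = chance_reach G 0 h * chance_reach G (length h) (h @ r)"
proof -
  let ?f = "\<lambda>h k. trans_prob G (pre_state G h k) (act_at h k) (post_state h k)"
  have "chance_reach G 0 (h @ r) =
      (\<Prod>k\<in>{0..<length h}. ?f (h @ r) k) * chance_reach G (length h) (h @ r)"
    unfolding chance_reach_def by (subst prod.atLeastLessThan_concat) auto
  also have "(\<Prod>k\<in>{0..<length h}. ?f (h @ r) k) = chance_reach G 0 h"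
    unfolding chance_reach_def by (intro prod.cong) (auto simp: nth_append)
  finally show ?thesis .
qed

lemma player_reach_append:
  "player_reach G \<pi> j 0 (h @ r) = player_reach G \<pi> j 0 h * player_reach G \<pi> j (length h) (h @ r)"
proof -
  let ?f = "\<lambda>h k. case act_at h k j of None \<Rightarrow> 1 | Some x \<Rightarrow> \<pi> j (info_state G j (take k h)) x"
  have "player_reach G \<pi> j 0 (h @ r) =
      (\<Prod>k\<in>{0..<length h}. ?f (h @ r) k) * player_reach G \<pi> j (length h) (h @ r)"
    unfolding player_reach_def by (subst prod.atLeastLessThan_concat) auto
  also have "(\<Prod>k\<in>{0..<length h}. ?f (h @ r) k) = player_reach G \<pi> j 0 h"
    unfolding player_reach_def by (intro prod.cong) (auto simp: nth_append split: option.split)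
  finally show ?thesis .
qed

lemma finite_players [simp]: "finite (players G)"
  by (simp add: players_def)

lemma reach_others:
  "i \<in> players G \<Longrightarrow> reach G \<pi> m h = others_reach G \<pi> i m h * player_reach G \<pi> i m h"
  by (simp add: reach_def others_reach_def prod.remove)

lemma others_reach_append:
  "others_reach G \<pi> i 0 (h @ r) = others_reach G \<pi> i 0 h * others_reach G \<pi> i (length h) (h @ r)"
  by (simp add: others_reach_def chance_reach_append[of G h] player_reach_append[of G _ _ h]
      prod.distrib)

lemma trans_prob_nonneg: "0 \<le> trans_prob G w a w'"
  by (simp add: trans_prob_def split: option.splits)

lemma others_reach_nonneg:
  assumes "\<And>j s x. 0 \<le> \<pi> j s x"
  shows "0 \<le> others_reach G \<pi> i m h"
  unfolding others_reach_def chance_reach_def player_reach_def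
  by (intro mult_nonneg_nonneg prod_nonneg) (auto simp: trans_prob_nonneg assms split: option.split)

section \<open>Forcing a player along a sequence of entries\<close>

text \<open>No history is mentioned: since information states contain the own actions, u alone tells
  where i is forced and to what. With \<open>u = s\<close> the forcing stops on arrival at s; with
  \<open>u = s @ [Act x]\<close> it includes the action at s. Off the path of u the policy stays, so
  that the result can be a profile again.\<close>

definition follow ::
    "('a, ('a, 'o) entry list) profile \<Rightarrow> nat \<Rightarrow> ('a, 'o) entry list \<Rightarrow>
     ('a, ('a, 'o) entry list) profile" where
  "follow \<pi> i u = \<pi>(i := \<lambda>s x.
     if \<exists>y r. u = s @ Act y # r then (if \<exists>r. u = s @ Act x # r then 1 else 0) else \<pi> i s x)"

lemma follow_other [simp]: "j \<noteq> i \<Longrightarrow> follow \<pi> i u j = \<pi> j"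
  by (simp add: follow_def)

lemma follow_beyond: "length u \<le> length s \<Longrightarrow> follow \<pi> i u i s = \<pi> i s"
  by (rule ext) (auto simp: follow_def)

lemma follow_Act [simp]: "follow \<pi> i (s @ Act x # r) i s y = (if x = y then 1 else 0)"
  by (auto simp: follow_def)

lemma follow_snoc_beyond: "t \<noteq> [] \<Longrightarrow> follow \<pi> i (s @ [Act x]) i (s @ t) = \<pi> i (s @ t)"
  by (rule follow_beyond) (cases t; simp)

lemma others_reach_follow [simp]: "others_reach G (follow \<pi> i u) i m h = others_reach G \<pi> i m h"
  by (simp add: others_reach_def player_reach_def cong: option.case_cong)

text \<open>By perfect recall each own action along h is one of those forced by
  \<open>info_state G i h\<close>, so every factor is 1. The surplus t covers both shapes of
  u.\<close>

lemma player_reach_follow: "player_reach G (follow \<pi> i (info_state G i h @ t)) i 0 h = 1"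
  unfolding player_reach_def
proof (rule prod.neutral, intro ballI)
  fix k assume k: "k \<in> {0..<length h}"
  show "(case act_at h k i of None \<Rightarrow> 1
    | Some x \<Rightarrow> follow \<pi> i (info_state G i h @ t) i (info_state G i (take k h)) x) = 1"
  proof (cases "act_at h k i")
    case (Some x)
    then obtain r where "info_state G i h = info_state G i (take k h) @ Act x # r"
      using k info_state_take_Act by (metis atLeastLessThan_iff)
    then show ?thesis using Some by simp
  qed simp
qed

lemma info_state_take_beyond:
  assumes "length h \<le> k" "k < length (h @ r)"
  obtains t where "info_state G i (take k (h @ r)) = info_state G i h @ t" "t = [] \<longleftrightarrow> k = length h"
proof -
  have "take k (h @ r) = h @ take (k - length h) r" using assms by simp
  moreover have "take (k - length h) r = [] \<longleftrightarrow> k = length h" using assms by auto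
  ultimately show ?thesis using that by (metis info_state_append)
qed

text \<open>From h on, all information states are at least as long as that of h, and nothing is
  forced there.\<close>

lemma player_reach_follow_beyond:
  "player_reach G (follow \<pi> i (info_state G i h)) i (length h) (h @ r) =
   player_reach G \<pi> i (length h) (h @ r)"
  unfolding player_reach_def
proof (rule prod.cong[OF refl])
  fix k assume "k \<in> {length h..<length (h @ r)}"
  then obtain t where "info_state G i (take k (h @ r)) = info_state G i h @ t"
    by (metis info_state_take_beyond atLeastLessThan_iff)
  then show "(case act_at (h @ r) k i of None \<Rightarrow> 1 | Some x \<Rightarrow>
       follow \<pi> i (info_state G i h) i (info_state G i (take k (h @ r))) x) =
    (case act_at (h @ r) k i of None \<Rightarrow> 1 | Some x \<Rightarrow> \<pi> i (info_state G i (take k (h @ r))) x)"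
    by (simp add: follow_beyond del: take_append cong: option.case_cong)
qed

text \<open>The factor of the transition out of h is split off and becomes 0 or 1. This turns the
  restriction of \<open>q_hist\<close> to trajectories starting with x into a weight. All later
  information states are strictly longer than that of h and so beyond the forcing.\<close>

lemma player_reach_follow_Act:
  assumes "fst e i = Some y"
  shows "player_reach G (follow \<pi> i (info_state G i h @ [Act x])) i (length h) (h @ e # r) =
    (if y = x then player_reach G \<pi> i (Suc (length h)) (h @ e # r) else 0)"
proof -
  let ?f = "follow \<pi> i (info_state G i h @ [Act x])"
  have "player_reach G ?f i (length h) (h @ e # r) =
      (if y = x then 1 else 0) * player_reach G ?f i (Suc (length h)) (h @ e # r)"
    unfolding player_reach_def using assms by (subst prod.atLeast_Suc_lessThan) auto
  also have "player_reach G ?f i (Suc (length h)) (h @ e # r) =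
      player_reach G \<pi> i (Suc (length h)) (h @ e # r)"
    unfolding player_reach_def
  proof (rule prod.cong[OF refl])
    fix k assume k: "k \<in> {Suc (length h)..<length (h @ e # r)}"
    then obtain t where "info_state G i (take k (h @ e # r)) = info_state G i h @ t" "t \<noteq> []"
      using info_state_take_beyond[of h k "e # r" G i]
      by (metis Suc_le_eq atLeastLessThan_iff less_imp_le less_not_refl)
    then show "(case act_at (h @ e # r) k i of None \<Rightarrow> 1 | Some x' \<Rightarrow>
         ?f i (info_state G i (take k (h @ e # r))) x') =
      (case act_at (h @ e # r) k i of None \<Rightarrow> 1 | Some x' \<Rightarrow> \<pi> i (info_state G i (take k (h @ e # r))) x')"
      by (simp add: follow_snoc_beyond del: take_append cong: option.case_cong)
  qed
  finally show ?thesis by simp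
qed

section \<open>Counterfactual values in the original game\<close>

lemma regret_matching_nonneg: "0 \<le> regret_matching A R x"
  by (simp add: regret_matching_def sum_nonneg)

lemma sum_regret_matching:
  assumes "finite A" "A \<noteq> {}"
  shows "(\<Sum>x\<in>A. regret_matching A R x) = 1"
proof (cases "(\<Sum>y\<in>A. max (R y) 0) = 0")
  case True
  then have "(\<Sum>x\<in>A. regret_matching A R x) = (\<Sum>x\<in>A. 1 / real (card A))"
    by (intro sum.cong) (auto simp: regret_matching_def)
  then show ?thesis using assms by simp
next
  case False
  then have "(\<Sum>x\<in>A. regret_matching A R x) = (\<Sum>x\<in>A. max (R x) 0 / (\<Sum>y\<in>A. max (R y) 0))"
    by (intro sum.cong) (auto simp: regret_matching_def)
  then show ?thesis using False by (simp flip: sum_divide_distrib)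
qed

lemma regret_matching_cong:
  assumes "\<And>x. x \<in> A \<Longrightarrow> R x = R' x"
  shows "regret_matching A R = regret_matching A R'"
  using assms by (intro ext) (simp add: regret_matching_def cong: sum.cong)

lemma cfr_eq: "cfr G t i s = regret_matching (legal_at G i s)
    (\<lambda>x. \<Sum>k<t. q_cf G (cfr G k) i s x - value_cf G (cfr G k) i s)"
  by (subst cfr.simps) simp

lemma efg_cfr_eq: "efg_cfr E t i I = regret_matching (efg_legal E I)
    (\<lambda>x. \<Sum>k<t. efg_q_cf E (efg_cfr E k) i I x - efg_value_cf E (efg_cfr E k) i I)"
  by (subst efg_cfr.simps) simp

text \<open>Unlike the nonnegativity in \<open>is_profile\<close>, this holds at all arguments,
  because \<open>regret_matching\<close> is 0 outside the legal actions.\<close>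

lemma cfr_nonneg: "0 \<le> cfr G t i s x"
  by (subst cfr_eq) (rule regret_matching_nonneg)

section \<open>Legal actions and profiles under the hypotheses of the theorem\<close>

locale FOSG_cfr = FOSG G
  for G :: "('w::topological_space, 'a::topological_space, 'o) fosg" +
  assumes finite_act: "finite_actions G"
    and integrable: "integrable_rewards G"
    and observable: "observable_rewards G"
begin

lemma last_state_states: "h \<in> histories G \<Longrightarrow> last_state G h \<in> states G"
proof (induction h rule: rev_induct)
  case (snoc e h)
  from snoc.prems obtain D where "h \<in> histories G" "fst e \<in> joint_legal G (last_state G h)"
    "trans G (last_state G h) (fst e) = Some D" "snd e \<in> set_pmf D"
    by (rule histories_snocD)
  with snoc.IH show ?case by (auto dest: trans_states)
qed (simp add: init_state)

lemma active_subset: "w \<in> states G \<Longrightarrow> i \<in> active G w \<Longrightarrow> i \<in> players G"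
  using active_players by blast

lemma finite_active [simp]: "w \<in> states G \<Longrightarrow> finite (active G w)"
  by (rule finite_subset[OF active_players finite_players])

lemma finite_legal: "w \<in> states G \<Longrightarrow> i \<in> active G w \<Longrightarrow> finite (legal G i w)"
  using finite_act by (simp add: finite_actions_def)

text \<open>\<open>legal_at\<close> is a union over all histories with the information state; by
  \<open>info_state_moves\<close> they all have the same moves.\<close>

lemma legal_at_eq:
  assumes "h \<in> acts_in G i"
  shows "legal_at G i (info_state G i h) = legal G i (last_state G h)"
proof -
  have h: "h \<in> histories G" "i \<in> active G (last_state G h)" using assms by (auto simp: acts_in_def)
  then have i: "i \<in> players G" using active_subset last_state_states by blast
  have m: "moves G i (last_state G h) = Some ` legal G i (last_state G h)"
    using h by (simp add: moves_def)
  have "legal_at G i (info_state G i h) = {x. Some x \<in> moves G i (last_state G h)}"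
    unfolding legal_at_def
  proof (intro Collect_cong iffI)
    fix x assume "\<exists>h'\<in>histories G. info_state G i h' = info_state G i h \<and> Some x \<in> moves G i (last_state G h')"
    then obtain h' where "h' \<in> histories G" "info_state G i h' = info_state G i h"
      "Some x \<in> moves G i (last_state G h')" by blast
    then show "Some x \<in> moves G i (last_state G h)"
      using info_state_moves[OF i _ h(1)] by metis
  qed (use h in blast)
  then show ?thesis unfolding m by auto
qed

text \<open>\<open>None\<close> is a move exactly of an inactive player, so equal sets of moves also
  force equal activity.\<close>

lemma acts_in_info_state_cong:
  assumes "i \<in> players G" "g \<in> acts_in G i" "h \<in> histories G" "info_state G i h = info_state G i g"
  shows "h \<in> acts_in G i"
proof -
  have "moves G i (last_state G h) = moves G i (last_state G g)"
    by (rule info_state_moves) (use assms in \<open>simp_all add: acts_in_def\<close>)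
  moreover have "i \<in> active G (last_state G g)" using assms(2) by (simp add: acts_in_def)
  ultimately have "None \<notin> moves G i (last_state G h)" by (auto simp: moves_def)
  then have "i \<in> active G (last_state G h)" by (simp add: moves_def split: if_splits)
  then show ?thesis using assms(3) by (simp add: acts_in_def)
qed

lemma
  assumes "s \<in> acting_info_states G i"
  shows finite_legal_at: "finite (legal_at G i s)" and legal_at_nonempty: "legal_at G i s \<noteq> {}"
proof -
  obtain h where h: "h \<in> acts_in G i" "s = info_state G i h"
    using assms by (auto simp: acting_info_states_def)
  then have "last_state G h \<in> states G" "i \<in> active G (last_state G h)"
    using last_state_states by (auto simp: acts_in_def)
  then show "finite (legal_at G i s)" "legal_at G i s \<noteq> {}"
    using h finite_legal legal_nonempty by (simp_all add: legal_at_eq)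
qed

lemma is_profile_iff: "is_profile G \<pi> \<longleftrightarrow> (\<forall>i\<in>players G. \<forall>s\<in>acting_info_states G i.
     (\<forall>x\<in>legal_at G i s. 0 \<le> \<pi> i s x) \<and> (\<Sum>x\<in>legal_at G i s. \<pi> i s x) = 1)"
proof -
  have "(\<pi> i s has_sum 1) (legal_at G i s) \<longleftrightarrow> (\<Sum>x\<in>legal_at G i s. \<pi> i s x) = 1"
    if "s \<in> acting_info_states G i" for i s
  proof
    assume "(\<pi> i s has_sum 1) (legal_at G i s)"
    with has_sum_finite[OF finite_legal_at[OF that]]
    show "(\<Sum>x\<in>legal_at G i s. \<pi> i s x) = 1" by (rule has_sum_unique)
  next
    assume "(\<Sum>x\<in>legal_at G i s. \<pi> i s x) = 1"
    then show "(\<pi> i s has_sum 1) (legal_at G i s)"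
      using has_sum_finite[OF finite_legal_at[OF that], of "\<pi> i s"] by simp
  qed
  then show ?thesis unfolding is_profile_def by (simp cong: ball_cong)
qed

lemma is_profile_cfr: "is_profile G (cfr G t)"
  unfolding is_profile_iff
  by (subst (2) cfr_eq) (simp add: cfr_nonneg sum_regret_matching finite_legal_at legal_at_nonempty)

text \<open>The recorded action was taken at some history with the information state of g, and
  \<open>legal_at\<close> collects the moves at all such histories.\<close>

lemma info_state_Act_legal:
  assumes "h \<in> histories G" "info_state G i h = info_state G i g @ Act x # r" "i \<in> players G"
  shows "x \<in> legal_at G i (info_state G i g)"
proof -
  from info_state_Act_split[OF assms(2)] obtain h1 e h2
    where h: "h = h1 @ e # h2" "info_state G i h1 = info_state G i g" "fst e i = Some x" by blast
  have "h1 @ [e] \<in> histories G" using assms(1) h(1) histories_appendD[of "h1 @ [e]" h2] by simp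
  then obtain D where "h1 \<in> histories G" "fst e \<in> joint_legal G (last_state G h1)"
    by (elim histories_snocD)
  moreover from this have "fst e i \<in> moves G i (last_state G h1)"
    using assms(3) by (simp add: joint_legal_def)
  ultimately show ?thesis
    unfolding legal_at_def using h(2,3) by auto
qed

text \<open>Forcing puts mass 1 on the entries of u, so \<open>follow\<close> is a profile only if
  these are legal actions; the two shapes that occur guarantee it.\<close>

definition followable :: "nat \<Rightarrow> ('a, 'o) entry list \<Rightarrow> bool" where
  "followable i u \<longleftrightarrow> (\<exists>h\<in>histories G. u = info_state G i h) \<or>
     (\<exists>h\<in>histories G. \<exists>x\<in>legal_at G i (info_state G i h). u = info_state G i h @ [Act x])"

lemma followable_Act_legal:
  assumes "followable i u" "u = info_state G i g @ Act y # r" "i \<in> players G"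
  shows "y \<in> legal_at G i (info_state G i g)"
proof -
  from assms(1) consider h where "h \<in> histories G" "u = info_state G i h"
    | h x where "h \<in> histories G" "x \<in> legal_at G i (info_state G i h)" "u = info_state G i h @ [Act x]"
    by (auto simp: followable_def)
  then show ?thesis
  proof cases
    case 1
    then show ?thesis using assms(2,3) info_state_Act_legal[of h i g y r] by simp
  next
    case 2
    show ?thesis
    \<comment> \<open>Either y is the appended action x itself, or it already lies in the
      information state of h.\<close>
    proof (cases r rule: rev_cases)
      case Nil
      then show ?thesis using 2 assms by simp
    next
      case (snoc r' z)
      then have "info_state G i h = info_state G i g @ Act y # r'" using 2 assms by simp
      then show ?thesis using 2(1) assms(3) info_state_Act_legal by blast
    qed
  qed
qed

text \<open>This is what allows \<open>ends\<close> and \<open>integrable_rewards\<close> to be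
  applied to forced play.\<close>

lemma is_profile_follow:
  assumes "is_profile G \<pi>" "followable i u"
  shows "is_profile G (follow \<pi> i u)"
  unfolding is_profile_iff
proof (intro ballI)
  fix j s assume j: "j \<in> players G" and s: "s \<in> acting_info_states G j"
  have *: "(\<forall>x\<in>legal_at G j s. 0 \<le> \<pi> j s x) \<and> (\<Sum>x\<in>legal_at G j s. \<pi> j s x) = 1"
    using assms(1) j s by (auto simp: is_profile_iff)
  show "(\<forall>x\<in>legal_at G j s. 0 \<le> follow \<pi> i u j s x) \<and> (\<Sum>x\<in>legal_at G j s. follow \<pi> i u j s x) = 1"
  proof (cases "j = i \<and> (\<exists>y r. u = s @ Act y # r)")
    case True
    then obtain y r where u: "u = s @ Act y # r" and [simp]: "j = i" by blast
    obtain g where g: "s = info_state G i g" using s by (auto simp: acting_info_states_def)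
    have "y \<in> legal_at G i s" using followable_Act_legal[OF assms(2)] u g j by simp
    moreover have "follow \<pi> i u j s x = (if y = x then 1 else 0)" for x
      unfolding u \<open>j = i\<close> by (rule follow_Act)
    ultimately show ?thesis using finite_legal_at[OF s] by simp
  next
    case False
    then have "follow \<pi> i u j s = \<pi> j s" unfolding follow_def by simp
    then show ?thesis using * by simp
  qed
qed

section \<open>Counterfactual values as sums over terminal histories\<close>

definition terminals_through :: "('w, 'a) history set \<Rightarrow> ('w, 'a) history set" where
  "terminals_through H = (\<Union>h\<in>H. {z \<in> terminal_histories G. prefix h z})"

lemma disjoint_terminals:
  "disjoint_family_on (\<lambda>h. {z \<in> terminal_histories G. prefix h z}) (info_histories G i s)"
  unfolding disjoint_family_on_def info_histories_def
  by (auto dest: prefix_info_state_eq)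

lemma summable_reach_terminals:
  assumes "is_profile G \<pi>" "Z \<subseteq> terminal_histories G"
  shows "reach G \<pi> 0 summable_on Z"
proof -
  have "((\<lambda>z. reach G \<pi> (length []) z) has_sum 1) {z \<in> terminal_histories G. prefix [] z}"
    using ends[OF assms(1) histories.empty] by simp
  then have "reach G \<pi> 0 summable_on terminal_histories G" by (simp add: has_sum_imp_summable)
  then show ?thesis using assms(2) summable_on_subset_banach by blast
qed

lemma summable_reach_reward:
  assumes "is_profile G \<pi>" "Z \<subseteq> terminal_histories G" "i \<in> players G"
  shows "(\<lambda>z. reach G \<pi> 0 z * cum_reward G i z) summable_on Z"
  using integrable assms summable_on_subset_banach unfolding integrable_rewards_def by blast

text \<open>
  The common shape of \<open>value_hist\<close> and \<open>q_hist\<close>: for \<open>u = s\<close> one gets the former, for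
  \<open>u = s @ [Act x]\<close> the latter.
\<close>

definition follow_value ::
    "('a, ('a, 'o) entry list) profile \<Rightarrow> nat \<Rightarrow> ('a, 'o) entry list \<Rightarrow> ('w, 'a) history \<Rightarrow> real" where
  "follow_value \<pi> i u h = (\<Sum>\<^sub>\<infinity>z\<in>{z \<in> terminal_histories G. prefix h z}.
     reach G (follow \<pi> i u) (length h) z * reward_from G i (length h) z)"

lemma value_hist_follow:
  assumes "i \<in> players G"
  shows "value_hist G \<pi> i h = follow_value \<pi> i (info_state G i h) h"
  unfolding value_hist_def follow_value_def
  using assms by (intro infsum_cong) (auto simp: reach_others player_reach_follow_beyond elim!: prefixE)

lemma acts_in_not_terminal: "h \<in> acts_in G i \<Longrightarrow> h \<notin> terminal_histories G"
  by (auto simp: acts_in_def terminal_histories_def terminal_def)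

lemma acts_in_Act:
  assumes "h \<in> acts_in G i" "h @ e # r \<in> histories G"
  obtains x where "fst e i = Some x" "x \<in> legal G i (last_state G h)"
proof -
  have "h @ [e] \<in> histories G" using assms(2) histories_appendD[of "h @ [e]" r] by simp
  then have "fst e \<in> joint_legal G (last_state G h)" by (elim histories_snocD)
  moreover have "i \<in> active G (last_state G h)" "i \<in> players G"
    using assms(1) active_subset[OF last_state_states] by (auto simp: acts_in_def)
  ultimately have "fst e i \<in> Some ` legal G i (last_state G h)"
    by (fastforce simp: joint_legal_def moves_def)
  then show ?thesis using that by blast
qed

text \<open>The right-hand sum ranges over more terminal histories, but those starting with another
  action have weight 0, and h itself is not terminal because i acts there.\<close>

lemma q_hist_follow:
  assumes "i \<in> players G" and h: "h \<in> acts_in G i"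
  shows "q_hist G \<pi> i h x = follow_value \<pi> i (info_state G i h @ [Act x]) h"
  unfolding q_hist_def follow_value_def
proof (rule infsum_cong_neutral, goal_cases)
  case (1 z)
  then have z: "z \<in> histories G" "prefix h z" "z \<noteq> h"
    using acts_in_not_terminal[OF h] by (auto simp: terminal_histories_def)
  then obtain e r where zr: "z = h @ e # r" by (metis append_self_conv list.exhaust prefixE)
  then obtain y where y: "fst e i = Some y" using acts_in_Act[OF h] z by metis
  then have "y \<noteq> x" using 1 zr by (auto simp: strict_prefix_def)
  then show ?case using assms(1) y by (simp add: reach_others zr player_reach_follow_Act)
next
  case (2 z)
  then show ?case by (auto simp: strict_prefix_def)
next
  case (3 z)
  then obtain e r where zr: "z = h @ e # r" by (auto elim: strict_prefixE')
  with 3 have "fst e i = Some x" by simp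
  then show ?case using assms(1) by (simp add: reach_others zr player_reach_follow_Act)
qed

text \<open>The only place where observability of rewards enters.\<close>

lemma info_histories_reward:
  assumes "i \<in> players G"
  shows "\<exists>c. \<forall>h\<in>info_histories G i s. cum_reward G i h = c"
proof (cases "info_histories G i s = {}")
  case False
  then obtain h0 where h0: "h0 \<in> histories G" "info_state G i h0 = s"
    by (auto simp: info_histories_def)
  have "cum_reward G i h = cum_reward G i h0" if "h \<in> info_histories G i s" for h
    by (rule observable[unfolded observable_rewards_def, rule_format, OF assms])
      (use that h0 in \<open>simp_all add: info_histories_def\<close>)
  then show ?thesis by blast
qed simp

text \<open>The term subtracted on the right does not depend on u, so it will drop out of the
  regrets. Summability of the counterfactual reach comes as a by-product, since it is the sum of W
  above each h.\<close>

lemma follow_value_total: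
  assumes "is_profile G \<pi>" "i \<in> players G" and c: "\<forall>h\<in>info_histories G i s. cum_reward G i h = c"
    and u: "u = s \<or> (\<exists>x\<in>legal_at G i s. u = s @ [Act x])"
  defines "W \<equiv> reach G (follow \<pi> i u) 0"
  shows "(\<Sum>\<^sub>\<infinity>h\<in>info_histories G i s. others_reach G \<pi> i 0 h * follow_value \<pi> i u h) =
      (\<Sum>\<^sub>\<infinity>z\<in>terminals_through (info_histories G i s). W z * cum_reward G i z)
      - others_reach_info G \<pi> i s * c"
    and "others_reach G \<pi> i 0 summable_on info_histories G i s"
proof -
  define H where "H = info_histories G i s"
  define T where "T = (\<lambda>h. {z \<in> terminal_histories G. prefix h z})"
  have Z: "terminals_through H = (\<Union>h\<in>H. T h)" "(\<Union>h\<in>H. T h) \<subseteq> terminal_histories G"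
    by (auto simp: terminals_through_def T_def)
  have disj: "disjoint_family_on T H"
    unfolding T_def H_def by (rule disjoint_terminals)
  have goal: "(\<Sum>\<^sub>\<infinity>h\<in>H. others_reach G \<pi> i 0 h * follow_value \<pi> i u h) =
      (\<Sum>\<^sub>\<infinity>z\<in>(\<Union>h\<in>H. T h). W z * cum_reward G i z) - others_reach_info G \<pi> i s * c
      \<and> others_reach G \<pi> i 0 summable_on H"
  proof (cases "H = {}")
    case True
    then show ?thesis using H_def by (simp add: others_reach_info_def)
  next
    case False
    then obtain h0 where h0: "h0 \<in> H" by blast
    then have h0': "h0 \<in> histories G" "info_state G i h0 = s"
      by (auto simp: H_def info_histories_def)
    then have "followable i u"
      unfolding followable_def using u by blast
    then have prof: "is_profile G (follow \<pi> i u)"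
      using assms(1) is_profile_follow by blast
    have c: "cum_reward G i h = c" if "h \<in> H" for h
      using that c by (simp add: H_def)
    \<comment> \<open>The reach of z is split at h; up to h the own factor of i is 1 by forcing, and
      the factors of the others ignore the forcing.\<close>
    have W: "W z = others_reach G \<pi> i 0 h * reach G (follow \<pi> i u) (length h) z"
      if "h \<in> H" "z \<in> T h" for h z
    proof -
      obtain r where z: "z = h @ r" using \<open>z \<in> T h\<close> by (auto simp: T_def elim: prefixE)
      obtain t where "u = info_state G i h @ t"
        using \<open>h \<in> H\<close> u by (auto simp: H_def info_histories_def)
      then show ?thesis
        using assms(2) by (simp add: W_def z reach_others others_reach_append[of G _ _ h]
            player_reach_append[of G _ _ h] player_reach_follow)
    qed
    have sW: "W summable_on (\<Union>h\<in>H. T h)"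
      unfolding W_def using prof Z(2) by (rule summable_reach_terminals)
    have sWR: "(\<lambda>z. W z * cum_reward G i z) summable_on (\<Union>h\<in>H. T h)"
      unfolding W_def using prof Z(2) assms(2) by (rule summable_reach_reward)
    \<comment> \<open>\<open>ends\<close>, applied at h to the forced profile: from h on the play
      terminates with total probability 1.\<close>
    have tot: "infsum W (T h) = others_reach G \<pi> i 0 h" if "h \<in> H" for h
    proof -
      have "infsum W (T h) =
          (\<Sum>\<^sub>\<infinity>z\<in>T h. others_reach G \<pi> i 0 h * reach G (follow \<pi> i u) (length h) z)"
        using W[OF that] by (rule infsum_cong)
      also have "\<dots> = others_reach G \<pi> i 0 h"
        unfolding infsum_cmult_right' T_def
        using infsumI[OF ends[OF prof, of h]] that by (simp add: H_def info_histories_def)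
      finally show ?thesis .
    qed
    have "(\<lambda>h. infsum W (T h)) summable_on H"
      using summable_on_disjoint_Union[OF disj sW] .
    then have s1: "others_reach G \<pi> i 0 summable_on H"
      by (rule summable_on_cong[THEN iffD1, rotated]) (rule tot)
    have "infsum W (\<Union>h\<in>H. T h) = (\<Sum>\<^sub>\<infinity>h\<in>H. infsum W (T h))"
      using infsum_disjoint_Union[OF disj sW] by simp
    also have "\<dots> = others_reach_info G \<pi> i s"
      unfolding others_reach_info_def H_def[symmetric] by (rule infsum_cong) (rule tot)
    finally have tot': "infsum W (\<Union>h\<in>H. T h) = others_reach_info G \<pi> i s" .
    have s2: "(\<lambda>z. W z * (cum_reward G i z - c)) summable_on (\<Union>h\<in>H. T h)"
      using summable_on_add[OF sWR summable_on_cmult_left[OF sW, of "- c"]]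
      by (simp add: algebra_simps)
    have "(\<Sum>\<^sub>\<infinity>h\<in>H. others_reach G \<pi> i 0 h * follow_value \<pi> i u h) =
        (\<Sum>\<^sub>\<infinity>h\<in>H. \<Sum>\<^sub>\<infinity>z\<in>T h. W z * (cum_reward G i z - c))"
    proof (rule infsum_cong)
      fix h assume h: "h \<in> H"
      \<comment> \<open>As h has cumulative reward c, the difference is the reward collected from h
        on.\<close>
      have "W z * (cum_reward G i z - c) = others_reach G \<pi> i 0 h *
          (reach G (follow \<pi> i u) (length h) z * reward_from G i (length h) z)" if tz: "z \<in> T h" for z
      proof -
        obtain r where z: "z = h @ r" using tz by (auto simp: T_def elim: prefixE)
        show ?thesis
          using W[OF h tz] c[OF h] cum_reward_append[of G i h r] unfolding z by simp
      qed
      then have "(\<Sum>\<^sub>\<infinity>z\<in>T h. W z * (cum_reward G i z - c)) =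
          (\<Sum>\<^sub>\<infinity>z\<in>T h. others_reach G \<pi> i 0 h *
             (reach G (follow \<pi> i u) (length h) z * reward_from G i (length h) z))"
        by (rule infsum_cong)
      then show "others_reach G \<pi> i 0 h * follow_value \<pi> i u h =
          (\<Sum>\<^sub>\<infinity>z\<in>T h. W z * (cum_reward G i z - c))"
        unfolding infsum_cmult_right' by (simp add: follow_value_def T_def)
    qed
    also have "\<dots> = (\<Sum>\<^sub>\<infinity>z\<in>(\<Union>h\<in>H. T h). W z * (cum_reward G i z - c))"
      by (rule infsum_disjoint_Union[OF disj s2])
    also have "\<dots> = (\<Sum>\<^sub>\<infinity>z\<in>(\<Union>h\<in>H. T h). W z * cum_reward G i z) - infsum W (\<Union>h\<in>H. T h) * c"
      using infsum_add[OF sWR summable_on_cmult_left[OF sW, of "- c"]]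
      unfolding infsum_cmult_left' by (simp add: algebra_simps)
    finally show ?thesis using s1 tot' by simp
  qed
  show "(\<Sum>\<^sub>\<infinity>h\<in>info_histories G i s. others_reach G \<pi> i 0 h * follow_value \<pi> i u h) =
      (\<Sum>\<^sub>\<infinity>z\<in>terminals_through (info_histories G i s). W z * cum_reward G i z)
      - others_reach_info G \<pi> i s * c"
    using goal Z(1) by (simp add: H_def)
  show "others_reach G \<pi> i 0 summable_on info_histories G i s"
    using goal by (simp add: H_def)
qed

text \<open>Both values are expanded with the same constant c, whose terms cancel. What remains
  mentions only terminal histories, W and cumulative rewards, and this is the form that the
  extensive-form side takes as well.\<close>

lemma regret_eq:
  assumes \<pi>: "is_profile G \<pi>" and i: "i \<in> players G" and s: "s \<in> acting_info_states G i"
    and x: "x \<in> legal_at G i s" and P: "others_reach_info G \<pi> i s \<noteq> 0"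
  shows "q_cf G \<pi> i s x - value_cf G \<pi> i s =
    (\<Sum>\<^sub>\<infinity>z\<in>terminals_through (info_histories G i s).
       reach G (follow \<pi> i (s @ [Act x])) 0 z * cum_reward G i z) -
    (\<Sum>\<^sub>\<infinity>z\<in>terminals_through (info_histories G i s).
       reach G (follow \<pi> i s) 0 z * cum_reward G i z)"
proof -
  have acts: "h \<in> acts_in G i" "info_state G i h = s" if "h \<in> info_histories G i s" for h
    using that s acts_in_info_state_cong[OF i]
    by (auto simp: info_histories_def acting_info_states_def)
  \<comment> \<open>The factor that makes a value counterfactual undoes the normalisation of the
    belief, provided that it is not 0.\<close>
  have cancel: "others_reach_info G \<pi> i s *
      (\<Sum>\<^sub>\<infinity>h\<in>info_histories G i s. belief G \<pi> i s h * v h) =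
      (\<Sum>\<^sub>\<infinity>h\<in>info_histories G i s. others_reach G \<pi> i 0 h * v h)" for v
    unfolding infsum_cmult_right'[symmetric] using P by (intro infsum_cong) (simp add: belief_def)
  have "q_cf G \<pi> i s x =
      (\<Sum>\<^sub>\<infinity>h\<in>info_histories G i s. others_reach G \<pi> i 0 h * follow_value \<pi> i (s @ [Act x]) h)"
    unfolding q_cf_def q_info_def cancel
    by (rule infsum_cong) (metis acts i q_hist_follow)
  moreover have "value_cf G \<pi> i s =
      (\<Sum>\<^sub>\<infinity>h\<in>info_histories G i s. others_reach G \<pi> i 0 h * follow_value \<pi> i s h)"
    unfolding value_cf_def value_info_def cancel
    by (rule infsum_cong) (metis acts i value_hist_follow)
  moreover obtain c where c: "\<forall>h\<in>info_histories G i s. cum_reward G i h = c"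
    using info_histories_reward[OF i] by blast
  ultimately show ?thesis
    using x by (simp add: follow_value_total(1)[OF \<pi> i c])
qed

end

section \<open>The serialized game\<close>

lemma serialize_simps [simp]:
  "players (serialize G) = players G"
  "init (serialize G) = entry_state G (init G)"
  "active (serialize G) (Decide w i b) = {i}"
  "active (serialize G) (Resolve w a) = {}"
  "legal (serialize G) i u = legal G i (base u)"
  "trans (serialize G) (Decide w i b) d = Some (return_pmf (next_state G w i (b(i := d i))))"
  "trans (serialize G) (Resolve w a) d = map_option (map_pmf (entry_state G)) (trans G w a)"
  "reward (serialize G) (Decide w i b) d j = 0"
  "reward (serialize G) (Resolve w a) d j = reward G w a j"
  by (simp_all add: serialize_def players_def)

lemma info_step_serialize [simp]:
  "info_step (serialize G) j (Decide w i b) e =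
     (case fst e j of None \<Rightarrow> [] | Some x \<Rightarrow> [Act x]) @ [Obs None None]"
  "info_step (serialize G) j (Resolve w a) e = (case fst e j of None \<Rightarrow> [] | Some x \<Rightarrow> [Act x]) @
     [Obs (Some (obs_priv G j w a (base (snd e)))) (Some (obs_pub G w a (base (snd e))))]"
  by (simp_all add: info_step_def serialize_def)

lemma base_entry_state [simp]: "base (entry_state G w) = w"
  by (simp add: entry_state_def)

lemma base_next_state [simp]: "base (next_state G w i b) = w"
  by (simp add: next_state_def)

text \<open>The part of a serialized play that \<open>unserialize\<close> forgets: the choices
  pending since the last resolved transition.\<close>

definition chosen :: "('w, 'a) sstate \<Rightarrow> 'a joint" where
  "chosen u = (case u of Decide w i b \<Rightarrow> b | Resolve w a \<Rightarrow> a)"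

lemma chosen_simps [simp]:
  "chosen (Decide w i b) = b" "chosen (Resolve w a) = a"
  "chosen (entry_state G w) = noops" "chosen (next_state G w i b) = b"
  by (simp_all add: chosen_def entry_state_def next_state_def)

lemma unserialize_Nil [simp]: "unserialize G [] = []"
  by (simp add: unserialize_def)

lemma unserialize_snoc [simp]:
  "unserialize G (g @ [e]) = unserialize G g @ (case last_state (serialize G) g of
     Decide w i b \<Rightarrow> [] | Resolve w a \<Rightarrow> [(a, base (snd e))])"
proof -
  let ?f = "\<lambda>g k. case pre_state (serialize G) g k of
       Decide w i b \<Rightarrow> [] | Resolve w a \<Rightarrow> [(a, base (post_state g k))]"
  have "unserialize G (g @ [e]) =
      concat (map (?f (g @ [e])) [0..<length g]) @ ?f (g @ [e]) (length g)"
    by (simp add: unserialize_def)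
  also have "map (?f (g @ [e])) [0..<length g] = map (?f g) [0..<length g]"
    by (intro map_cong) (auto simp: nth_append split: sstate.split)
  finally show ?thesis by (simp add: unserialize_def cong: sstate.case_cong)
qed

lemma unserialize_append:
  obtains r' where "unserialize G (g @ r) = unserialize G g @ r'"
proof -
  have "\<exists>r'. unserialize G (g @ r) = unserialize G g @ r'"
  proof (induction r rule: rev_induct)
    case (snoc e r)
    then show ?case by (metis append_assoc unserialize_snoc)
  qed simp
  then show ?thesis using that by blast
qed

lemma joint_legal_Decide:
  assumes "d \<in> joint_legal (serialize G) (Decide w i b)" "i \<in> players G"
  obtains x where "x \<in> legal G i w" "d = noops(i := Some x)"
proof -
  have d: "\<And>j. j \<in> players G \<Longrightarrow> d j \<in> moves (serialize G) j (Decide w i b)"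
    "\<And>j. j \<notin> players G \<Longrightarrow> d j = None"
    using assms(1) by (auto simp: joint_legal_def)
  from d(1)[OF assms(2)] obtain x where x: "x \<in> legal G i w" "d i = Some x"
    by (auto simp: moves_def)
  have "d j = None" if "j \<noteq> i" for j
    using d(1)[of j] d(2)[of j] that by (cases "j \<in> players G") (simp_all add: moves_def)
  then have "d = noops(i := Some x)" using x(2) by auto
  with x(1) that show ?thesis by blast
qed

lemma joint_legal_Resolve: "d \<in> joint_legal (serialize G) (Resolve w a) \<longleftrightarrow> d = noops"
  by (auto simp: joint_legal_def moves_def)

section \<open>Invariants of serialized histories\<close>

context FOSG_cfr
begin

text \<open>The conditions of \<open>states (serialize G)\<close> except
  \<open>w \<in> states G\<close>, which comes from w being the last state of a history of the
  original game.\<close>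

definition proper :: "('w, 'a) sstate \<Rightarrow> bool" where
  "proper u \<longleftrightarrow> (case u of
     Decide w i b \<Rightarrow> i \<in> active G w \<and> b \<in> partial_legal G w i
   | Resolve w a \<Rightarrow> a \<in> joint_legal G w)"

lemma proper_simps [simp]:
  "proper (Decide w i b) \<longleftrightarrow> i \<in> active G w \<and> b \<in> partial_legal G w i"
  "proper (Resolve w a) \<longleftrightarrow> a \<in> joint_legal G w"
  by (simp_all add: proper_def)

lemma proper_entry_state:
  assumes "w \<in> states G"
  shows "proper (entry_state G w)"
proof (cases "active G w = {}")
  case True
  then show ?thesis by (simp add: entry_state_def joint_legal_def moves_def)
next
  case False
  then have "Min (active G w) \<in> active G w" "\<And>j. j \<in> active G w \<Longrightarrow> \<not> j < Min (active G w)"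
    using assms finite_active by (auto simp: not_less)
  with False show ?thesis by (auto simp: entry_state_def partial_legal_def)
qed

lemma proper_next_state:
  assumes w: "w \<in> states G" and i: "i \<in> active G w" and b: "b \<in> partial_legal G w i"
    and x: "x \<in> legal G i w"
  shows "proper (next_state G w i (b(i := Some x)))"
proof -
  let ?b = "b(i := Some x)" and ?J = "{j \<in> active G w. i < j}"
  have some: "?b j \<in> Some ` legal G j w" if "j \<in> active G w" "j \<le> i" for j
    using that b x by (cases "j = i") (auto simp: partial_legal_def)
  have none: "?b j = None" if "\<not> (j \<in> active G w \<and> j \<le> i)" for j
    using that b i by (auto simp: partial_legal_def)
  show ?thesis
  proof (cases "\<exists>j\<in>active G w. i < j")
    case True
    have fin: "finite ?J" using w by simp
    have "?J \<noteq> {}" using True by blast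
    then have J: "Min ?J \<in> active G w" "i < Min ?J" using Min_in[OF fin] by auto
    \<comment> \<open>No active player lies strictly between i and \<open>Min ?J\<close>, so the
      choices made so far have exactly the domain required at the next decision.\<close>
    have iff: "j < Min ?J \<longleftrightarrow> j \<le> i" if "j \<in> active G w" for j
      using Min_le[OF fin, of j] that J(2) by (cases "i < j") auto
    have "?b \<in> partial_legal G w (Min ?J)"
      unfolding partial_legal_def using some none iff by blast
    then show ?thesis using True J by (simp add: next_state_def)
  next
    case False
    have "?b j \<in> moves G j w" for j
    proof (cases "j \<in> active G w")
      case True
      then show ?thesis using some[of j] False
        by (auto simp: moves_def not_less simp del: fun_upd_apply)
    next
      case False
      then show ?thesis using none[of j] by (simp add: moves_def del: fun_upd_apply)
    qed
    moreover have "?b j = None" if "j \<notin> players G" for j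
      using none[of j] active_subset[OF w, of j] that by blast
    ultimately have "?b \<in> joint_legal G w"
      unfolding joint_legal_def by blast
    then show ?thesis unfolding next_state_def if_not_P[OF False] by simp
  qed
qed

lemma serial_step:
  assumes "g @ [e] \<in> histories (serialize G)" "proper (last_state (serialize G) g)"
    "base (last_state (serialize G) g) \<in> states G"
  obtains (Decide) w i b x where "last_state (serialize G) g = Decide w i b" "i \<in> active G w"
      "b \<in> partial_legal G w i" "x \<in> legal G i w"
      "e = (noops(i := Some x), next_state G w i (b(i := Some x)))"
  | (Resolve) w a w' D where "last_state (serialize G) g = Resolve w a" "a \<in> joint_legal G w"
      "trans G w a = Some D" "w' \<in> set_pmf D" "e = (noops, entry_state G w')"
proof -
  from assms(1) obtain D where D: "fst e \<in> joint_legal (serialize G) (last_state (serialize G) g)"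
    "trans (serialize G) (last_state (serialize G) g) (fst e) = Some D" "snd e \<in> set_pmf D"
    by (rule histories_snocD)
  show ?thesis
  proof (cases "last_state (serialize G) g")
    case (Decide w i b)
    from assms(2) have i: "i \<in> active G w" "b \<in> partial_legal G w i" by (simp_all add: Decide)
    from assms(3) i(1) have "i \<in> players G" using active_subset by (simp add: Decide)
    with D(1) obtain x where x: "x \<in> legal G i w" "fst e = noops(i := Some x)"
      unfolding Decide by (rule joint_legal_Decide)
    from D(2,3) x(2) have "snd e = next_state G w i (b(i := Some x))" by (auto simp: Decide)
    with x(2) have "e = (noops(i := Some x), next_state G w i (b(i := Some x)))"
      by (simp add: prod_eq_iff)
    with that(1) Decide i x show ?thesis by blast
  next
    case (Resolve w a)
    with assms have a: "a \<in> joint_legal G w" by simp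
    have e: "fst e = noops" using D(1) Resolve by (simp add: joint_legal_Resolve)
    from D(2) Resolve obtain D' where D': "trans G w a = Some D'" "D = map_pmf (entry_state G) D'"
      by auto
    with D(3) obtain w' where "w' \<in> set_pmf D'" "snd e = entry_state G w'" by auto
    with e have "e = (noops, entry_state G w')" "w' \<in> set_pmf D'" by (simp_all add: prod_eq_iff)
    with that(2) Resolve a D' show ?thesis by blast
  qed
qed

text \<open>The invariants are proved jointly: \<open>serial_step\<close> needs the state to be
  proper with its base in \<open>states G\<close>, and the latter comes from the unserialized
  history.\<close>

lemma serial_history:
  assumes "g \<in> histories (serialize G)"
  shows serial_history_unserialize: "unserialize G g \<in> histories G"
    and serial_history_base: "base (last_state (serialize G) g) = last_state G (unserialize G g)"
    and serial_history_proper: "proper (last_state (serialize G) g)"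
proof -
  have "unserialize G g \<in> histories G \<and>
     base (last_state (serialize G) g) = last_state G (unserialize G g) \<and>
     proper (last_state (serialize G) g)"
    using assms
  proof (induction g rule: rev_induct)
    case Nil
    then show ?case by (simp add: histories.empty proper_entry_state init_state)
  next
    case (snoc e g)
    from snoc.prems have "g \<in> histories (serialize G)" by (rule histories_appendD)
    then have IH: "unserialize G g \<in> histories G"
      "base (last_state (serialize G) g) = last_state G (unserialize G g)"
      "proper (last_state (serialize G) g)"
      using snoc.IH by auto
    from IH have st: "base (last_state (serialize G) g) \<in> states G"
      using last_state_states by simp
    from snoc.prems IH(3) st show ?case
    proof (cases rule: serial_step)
      case (Decide w i b x)
      then show ?thesis using IH st proper_next_state[of w i b x] by simp
    next
      case (Resolve w a w' D)
      then have w: "w = last_state G (unserialize G g)" using IH by simp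
      have "unserialize G g @ [(a, w')] \<in> histories G"
        using histories.snoc[OF IH(1), of a D w'] Resolve(2,3,4) unfolding w by simp
      moreover from last_state_states[OF this] have "w' \<in> states G" by simp
      ultimately show ?thesis using Resolve(1,5) by (simp add: proper_entry_state)
    qed
  qed
  then show "unserialize G g \<in> histories G"
    "base (last_state (serialize G) g) = last_state G (unserialize G g)"
    "proper (last_state (serialize G) g)" by simp_all
qed

lemma serial_cases [consumes 1, case_names empty Decide Resolve]:
  assumes "g' \<in> histories (serialize G)"
  obtains "g' = []"
  | g w i b x where "g' = g @ [(noops(i := Some x), next_state G w i (b(i := Some x)))]"
      "g \<in> histories (serialize G)" "last_state (serialize G) g = Decide w i b"
      "w = last_state G (unserialize G g)" "i \<in> active G w" "b \<in> partial_legal G w i"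
      "x \<in> legal G i w"
  | g w a w' D where "g' = g @ [(noops, entry_state G w')]"
      "g \<in> histories (serialize G)" "last_state (serialize G) g = Resolve w a"
      "w = last_state G (unserialize G g)" "a \<in> joint_legal G w" "trans G w a = Some D"
      "w' \<in> set_pmf D"
proof (cases g' rule: rev_cases)
  case (snoc g e)
  from assms have g: "g \<in> histories (serialize G)" unfolding snoc by (rule histories_appendD)
  note inv = serial_history[OF g]
  have "base (last_state (serialize G) g) \<in> states G"
    using inv last_state_states by simp
  with assms[unfolded snoc] inv(3) show ?thesis
  proof (cases rule: serial_step)
    case (Decide w i b x)
    then have "w = last_state G (unserialize G g)" using inv by simp
    then show ?thesis using that(2)[of g i x w b] snoc g Decide by blast
  next
    case (Resolve w a w' D)
    then have "w = last_state G (unserialize G g)" using inv by simp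
    then show ?thesis using that(3)[of g w' w a D] snoc g Resolve by blast
  qed
qed

lemma serial_induct [consumes 1, case_names empty Decide Resolve]:
  assumes "g \<in> histories (serialize G)"
    and "P []"
    and "\<And>g w i b x. g \<in> histories (serialize G) \<Longrightarrow> P g \<Longrightarrow>
      last_state (serialize G) g = Decide w i b \<Longrightarrow> w = last_state G (unserialize G g) \<Longrightarrow>
      i \<in> active G w \<Longrightarrow> b \<in> partial_legal G w i \<Longrightarrow> x \<in> legal G i w \<Longrightarrow>
      P (g @ [(noops(i := Some x), next_state G w i (b(i := Some x)))])"
    and "\<And>g w a w' D. g \<in> histories (serialize G) \<Longrightarrow> P g \<Longrightarrow>
      last_state (serialize G) g = Resolve w a \<Longrightarrow> w = last_state G (unserialize G g) \<Longrightarrow>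
      a \<in> joint_legal G w \<Longrightarrow> trans G w a = Some D \<Longrightarrow> w' \<in> set_pmf D \<Longrightarrow>
      P (g @ [(noops, entry_state G w')])"
  shows "P g"
  using assms(1)
proof (induction "length g" arbitrary: g rule: less_induct)
  case less
  from less.prems show ?case
  proof (cases rule: serial_cases)
    case empty
    then show ?thesis using assms(2) by simp
  next
    case (Decide g1 w i b x)
    have "P g1" using less.hyps[of g1] Decide(1,2) by simp
    from assms(3)[OF Decide(2) this Decide(3-7)] show ?thesis unfolding Decide(1) .
  next
    case (Resolve g1 w a w' D)
    have "P g1" using less.hyps[of g1] Resolve(1,2) by simp
    from assms(4)[OF Resolve(2) this Resolve(3-7)] show ?thesis unfolding Resolve(1) .
  qed
qed

text \<open>Injectivity ensures that mapping a transition distribution along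
  \<open>entry_state\<close> keeps its point probabilities.\<close>

lemma entry_state_injective: "inj (entry_state G)"
  by (metis base_entry_state injI)

section \<open>Rewards and information states of serialized histories\<close>

lemma cum_reward_serialize:
  "g \<in> histories (serialize G) \<Longrightarrow> cum_reward (serialize G) i g = cum_reward G i (unserialize G g)"
  by (induction g rule: serial_induct) simp_all

text \<open>In both games the own action precedes the observation of the same transition. While a
  round is unresolved, only a pending choice of i is ahead of the original information state. The
  filter removes nothing that a resolving step observes, as those observations are wrapped in
  \<open>Some\<close>.\<close>

lemma serial_info_state_unserialize:
  "g \<in> histories (serialize G) \<Longrightarrow>
   serial_info_state G i g = map (map_entry id Some) (info_state G i (unserialize G g)) @
     (case chosen (last_state (serialize G) g) i of None \<Rightarrow> [] | Some x \<Rightarrow> [Act x])"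
proof (induction g rule: serial_induct)
  case empty
  then show ?case by (simp add: serial_info_state_def)
next
  case (Decide g w j b x)
  then show ?case
    by (cases "i = j") (auto simp: serial_info_state_def partial_legal_def)
next
  case (Resolve g w a w' D)
  then show ?case
    by (auto simp: serial_info_state_def info_step_def[of G] split: option.splits)
qed

lemma acts_in_serial:
  "g \<in> acts_in (serialize G) i \<longleftrightarrow>
   g \<in> histories (serialize G) \<and> (\<exists>w b. last_state (serialize G) g = Decide w i b)"
  by (cases "last_state (serialize G) g") (auto simp: acts_in_def)

lemma acts_in_serialD:
  assumes "g \<in> acts_in (serialize G) i"
  obtains b where "g \<in> histories (serialize G)"
    "last_state (serialize G) g = Decide (last_state G (unserialize G g)) i b"
    "i \<in> active G (last_state G (unserialize G g))"
    "b \<in> partial_legal G (last_state G (unserialize G g)) i" "b i = None"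
    "unserialize G g \<in> acts_in G i"
proof -
  from assms obtain w b where g: "g \<in> histories (serialize G)"
    "last_state (serialize G) g = Decide w i b" by (auto simp: acts_in_serial)
  with serial_history[OF g(1)] have "w = last_state G (unserialize G g)" by simp
  with g serial_history[OF g(1)] that show ?thesis
    by (auto simp: partial_legal_def acts_in_def)
qed

lemma serial_info_state_acts_in:
  assumes "g \<in> acts_in (serialize G) i"
  shows "serial_info_state G i g = map (map_entry id Some) (info_state G i (unserialize G g))"
proof -
  from assms obtain b where "g \<in> histories (serialize G)"
    "last_state (serialize G) g = Decide (last_state G (unserialize G g)) i b" "b i = None"
    by (rule acts_in_serialD)
  then show ?thesis using serial_info_state_unserialize[of g i] by simp
qed

lemma serial_info_state_eq_iff:
  assumes "g \<in> acts_in (serialize G) i" "g' \<in> acts_in (serialize G) i"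
  shows "serial_info_state G i g = serial_info_state G i g' \<longleftrightarrow>
    info_state G i (unserialize G g) = info_state G i (unserialize G g')"
proof -
  have "inj (map_entry id Some :: ('a, 'o) entry \<Rightarrow> ('a, 'o option) entry)"
    by (rule entry.inj_map) auto
  then show ?thesis using assms by (simp add: serial_info_state_acts_in inj_map_eq_map)
qed

text \<open>The action taken at \<open>g\<close> is recorded in the later information states.\<close>

lemma acts_in_serial_append:
  assumes "g \<in> acts_in (serialize G) i" "g @ r \<in> acts_in (serialize G) i"
    "info_state G i (unserialize G g) = info_state G i (unserialize G (g @ r))"
  shows "r = []"
proof (rule ccontr)
  assume "r \<noteq> []"
  then obtain e r' where r: "r = e # r'" by (cases r) auto
  from assms(1) obtain b where g: "g \<in> histories (serialize G)"
    "last_state (serialize G) g = Decide (last_state G (unserialize G g)) i b"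
    "i \<in> active G (last_state G (unserialize G g))"
    by (rule acts_in_serialD)
  have "g @ [e] \<in> histories (serialize G)"
    using assms(2) histories_appendD[of "g @ [e]" r' "serialize G"] by (simp add: r acts_in_def)
  then obtain D where "fst e \<in> joint_legal (serialize G) (last_state (serialize G) g)"
    by (rule histories_snocD)
  moreover have "i \<in> players G"
    using g(3) active_subset[OF last_state_states[OF serial_history_unserialize[OF g(1)]]] by simp
  ultimately obtain x where x: "fst e = noops(i := Some x)"
    unfolding g(2) by (rule joint_legal_Decide)
  obtain t where "info_state (serialize G) i (g @ r) = info_state (serialize G) i (g @ [e]) @ t"
    using info_state_append[of "serialize G" i "g @ [e]" r'] by (auto simp: r)
  then have "length (serial_info_state G i (g @ r)) > length (serial_info_state G i g)"
    using g(2) x by (simp add: serial_info_state_def)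
  moreover have "serial_info_state G i g = serial_info_state G i (g @ r)"
    using serial_info_state_eq_iff[OF assms(1,2)] assms(3) by blast
  ultimately show False by simp
qed

text \<open>Strict growth of the original information state does not give this, since decision steps
  leave the unserialized history unchanged. It rests on i choosing at most once per round.\<close>

lemma infoset_map_antichain:
  assumes "g \<in> infoset_map G i s" "g' \<in> infoset_map G i s" "prefix g z" "prefix g' z"
  shows "g = g'"
proof -
  have eq: "g = g @ r" if "g \<in> infoset_map G i s" "g @ r \<in> infoset_map G i s" for g r
    using that acts_in_serial_append[of g i r] by (simp add: infoset_map_def)
  consider "prefix g g'" | "prefix g' g"
    using prefix_same_cases[OF assms(3,4)] by blast
  then show ?thesis
  proof cases
    case 1
    then show ?thesis using eq[of g] assms(1,2) by (auto elim!: prefixE)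
  next
    case 2
    then show ?thesis using eq[of g'] assms(1,2) by (auto elim!: prefixE)
  qed
qed

section \<open>Lifting histories to the serialized game\<close>

definition cut :: "nat \<Rightarrow> 'a joint \<Rightarrow> 'a joint" where
  "cut n a = (\<lambda>j. if j < n then a j else None)"

text \<open>The state in which the players below \<open>n\<close> have made the choices prescribed by \<open>a\<close>.\<close>

definition stage :: "'w \<Rightarrow> nat \<Rightarrow> 'a joint \<Rightarrow> ('w, 'a) sstate" where
  "stage w n a = (if \<exists>j\<in>active G w. n \<le> j then Decide w (Min {j \<in> active G w. n \<le> j}) (cut n a)
     else Resolve w (cut n a))"

lemma stage_0: "stage w 0 a = entry_state G w"
proof (cases "active G w = {}")
  case False
  then have "\<exists>j\<in>active G w. 0 \<le> j" by blast
  then show ?thesis using False by (simp add: stage_def entry_state_def cut_def)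
qed (simp add: stage_def entry_state_def cut_def)

lemma stage_active:
  assumes "w \<in> states G" "i \<in> active G w"
  shows "stage w i a = Decide w i (cut i a)"
proof -
  have "Min {j \<in> active G w. i \<le> j} = i"
    using assms by (intro Min_eqI) simp_all
  moreover have "\<exists>j\<in>active G w. i \<le> j" using assms(2) by blast
  ultimately show ?thesis by (simp add: stage_def)
qed

lemma joint_legalD:
  assumes "w \<in> states G" "a \<in> joint_legal G w"
  shows "j \<in> active G w \<Longrightarrow> a j \<in> Some ` legal G j w" and "j \<notin> active G w \<Longrightarrow> a j = None"
proof -
  have a: "\<And>j. j \<in> players G \<Longrightarrow> a j \<in> moves G j w" "\<And>j. j \<notin> players G \<Longrightarrow> a j = None"
    using assms(2) by (simp_all add: joint_legal_def)
  show "j \<in> active G w \<Longrightarrow> a j \<in> Some ` legal G j w"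
    using a(1)[of j] active_subset[OF assms(1), of j] by (simp add: moves_def)
  show "j \<notin> active G w \<Longrightarrow> a j = None"
    using a[of j] by (cases "j \<in> players G") (simp_all add: moves_def)
qed

lemma partial_legal_less: "b \<in> partial_legal G w i \<Longrightarrow> b j \<noteq> None \<Longrightarrow> j < i"
  by (rule ccontr) (simp add: partial_legal_def)

text \<open>Players are numbered from 1 to \<open>nplayers G\<close>, so all of them are below n
  only from \<open>Suc (nplayers G)\<close> on.\<close>

lemma stage_last:
  assumes "w \<in> states G" "a \<in> joint_legal G w"
  shows "stage w (Suc (nplayers G)) a = Resolve w a"
proof -
  have le: "j < Suc (nplayers G)" if "j \<in> active G w" for j
    using active_subset[OF assms(1) that] by (simp add: players_def)
  have "cut (Suc (nplayers G)) a j = a j" for j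
    using joint_legalD(2)[OF assms, of j] le[of j] unfolding cut_def by (metis (full_types))
  then have "cut (Suc (nplayers G)) a = a" by (rule ext)
  moreover have "\<not> (\<exists>j\<in>active G w. Suc (nplayers G) \<le> j)"
    using le leD Suc_le_eq by (meson not_less_eq_eq)
  ultimately show ?thesis unfolding stage_def by (simp only: if_False)
qed

lemma cut_Suc_inactive:
  assumes "n \<notin> active G w" "w \<in> states G" "a \<in> joint_legal G w"
  shows "cut (Suc n) a = cut n a"
proof (rule ext)
  fix j
  show "cut (Suc n) a j = cut n a j"
    using joint_legalD(2)[OF assms(2,3,1)] by (cases "j = n") (simp_all add: cut_def less_Suc_eq)
qed

lemma cut_Suc: "cut (Suc n) a = (cut n a)(n := a n)"
  by (auto simp: cut_def fun_eq_iff less_Suc_eq)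

text \<open>\<open>next_state\<close> searches strictly above n and \<open>stage\<close> from
  \<open>Suc n\<close> on, which are the same players; for active n this is the state that the
  choice of n leads to.\<close>

lemma stage_Suc:
  "stage w (Suc n) a = next_state G w n ((cut n a)(n := a n))"
  unfolding stage_def next_state_def cut_Suc Suc_le_eq ..

lemma stage_Suc_inactive:
  assumes "n \<notin> active G w" "w \<in> states G" "a \<in> joint_legal G w"
  shows "stage w (Suc n) a = stage w n a"
proof -
  have "n \<le> j \<longleftrightarrow> Suc n \<le> j" if "j \<in> active G w" for j
    using that assms(1) by (cases "j = n") auto
  then have "{j \<in> active G w. n \<le> j} = {j \<in> active G w. Suc n \<le> j}"
    "(\<exists>j\<in>active G w. n \<le> j) \<longleftrightarrow> (\<exists>j\<in>active G w. Suc n \<le> j)" by auto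
  then show ?thesis unfolding stage_def cut_Suc_inactive[OF assms] by simp
qed

text \<open>An inactive n costs no transition; therefore the conclusion speaks of an extension g'
  that may be g itself.\<close>

lemma stage_step:
  assumes g: "g \<in> histories (serialize G)" "last_state (serialize G) g = stage w n a"
    and w: "w \<in> states G" and a: "a \<in> joint_legal G w"
  obtains g' where "g' \<in> histories (serialize G)" "prefix g g'"
    "unserialize G g' = unserialize G g" "last_state (serialize G) g' = stage w (Suc n) a"
proof (cases "n \<in> active G w")
  case True
  let ?e = "(noops(n := a n), stage w (Suc n) a)"
  obtain x where x: "x \<in> legal G n w" "a n = Some x"
    using joint_legalD(1)[OF w a True] by auto
  have last: "last_state (serialize G) g = Decide w n (cut n a)"
    using g(2) stage_active[OF w True] by simp
  have "noops(n := a n) \<in> joint_legal (serialize G) (Decide w n (cut n a))"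
    using active_subset[OF w True] x by (auto simp: joint_legal_def moves_def)
  then have "g @ [?e] \<in> histories (serialize G)"
    using histories.snoc[OF g(1), of "noops(n := a n)" _ "stage w (Suc n) a"]
    by (simp add: last stage_Suc)
  then show ?thesis using that[of "g @ [?e]"] by (simp add: last)
next
  case False
  then show ?thesis using that[OF g(1)] g(2) stage_Suc_inactive[OF False w a] by simp
qed

lemma stage_reach:
  assumes "n \<le> m" and g: "g \<in> histories (serialize G)" "last_state (serialize G) g = stage w n a"
    and w: "w \<in> states G" and a: "a \<in> joint_legal G w"
  obtains g' where "g' \<in> histories (serialize G)" "prefix g g'"
    "unserialize G g' = unserialize G g" "last_state (serialize G) g' = stage w m a"
proof -
  from assms(1) have "\<exists>g'. g' \<in> histories (serialize G) \<and> prefix g g' \<and>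
    unserialize G g' = unserialize G g \<and> last_state (serialize G) g' = stage w m a"
  proof (induction m rule: dec_induct)
    case base
    then show ?case using g by (intro exI[of _ g]) simp
  next
    case (step m)
    then obtain g' where g': "g' \<in> histories (serialize G)" "prefix g g'"
      "unserialize G g' = unserialize G g" "last_state (serialize G) g' = stage w m a" by blast
    from g'(1,4) w a obtain g'' where "g'' \<in> histories (serialize G)" "prefix g' g''"
      "unserialize G g'' = unserialize G g'" "last_state (serialize G) g'' = stage w (Suc m) a"
      by (rule stage_step)
    with g'(2,3) show ?case by (intro exI[of _ g'']) (simp add: prefix_order.trans[of g g' g''])
  qed
  then show ?thesis using that by blast
qed

text \<open>The round may already be under way at g, which makes it possible to continue from a node
  where player i is about to choose.\<close>

lemma serial_snoc:
  assumes g: "g \<in> histories (serialize G)"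
    "last_state (serialize G) g = stage (last_state G (unserialize G g)) n a"
    and n: "n \<le> Suc (nplayers G)" and h: "unserialize G g @ [(a, w')] \<in> histories G"
  obtains g' where "g' \<in> histories (serialize G)" "prefix g g'"
    "unserialize G g' = unserialize G g @ [(a, w')]" "last_state (serialize G) g' = entry_state G w'"
proof -
  let ?w = "last_state G (unserialize G g)"
  have w: "?w \<in> states G"
    using last_state_states[OF serial_history_unserialize[OF g(1)]] .
  from h obtain D where D: "a \<in> joint_legal G ?w" "trans G ?w a = Some D" "w' \<in> set_pmf D"
    by (rule histories_snocD) simp
  from n g w D(1) obtain g' where g': "g' \<in> histories (serialize G)" "prefix g g'"
    "unserialize G g' = unserialize G g"
    "last_state (serialize G) g' = stage ?w (Suc (nplayers G)) a"
    by (rule stage_reach)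
  let ?g = "g' @ [(noops, entry_state G w')]"
  have last: "last_state (serialize G) g' = Resolve ?w a"
    using g'(4) stage_last[OF w D(1)] by simp
  have "?g \<in> histories (serialize G)"
    using histories.snoc[OF g'(1), of noops "map_pmf (entry_state G) D" "entry_state G w'"] D(2,3)
    by (simp add: last joint_legal_Resolve)
  with that[of ?g] g'(2,3) show ?thesis by (simp add: last)
qed

lemma serial_extend:
  assumes g: "g \<in> histories (serialize G)"
    "last_state (serialize G) g = entry_state G (last_state G (unserialize G g))"
    and h: "unserialize G g @ r \<in> histories G"
  obtains g' where "g' \<in> histories (serialize G)" "prefix g g'"
    "unserialize G g' = unserialize G g @ r"
    "last_state (serialize G) g' = entry_state G (last_state G (unserialize G g @ r))"
proof -
  from h have "\<exists>g'. g' \<in> histories (serialize G) \<and> prefix g g' \<and>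
    unserialize G g' = unserialize G g @ r \<and>
    last_state (serialize G) g' = entry_state G (last_state G (unserialize G g @ r))"
  proof (induction r rule: rev_induct)
    case Nil
    then show ?case using g by (intro exI[of _ g]) simp
  next
    case (snoc e r)
    obtain a w' where e: "e = (a, w')" by (cases e)
    have "unserialize G g @ r \<in> histories G"
      using snoc.prems histories_appendD[of "unserialize G g @ r" "[e]" G] by simp
    from snoc.IH[OF this] obtain g' where g': "g' \<in> histories (serialize G)" "prefix g g'"
      "unserialize G g' = unserialize G g @ r"
      "last_state (serialize G) g' = entry_state G (last_state G (unserialize G g @ r))" by blast
    have "last_state (serialize G) g' = stage (last_state G (unserialize G g')) 0 a"
      using g'(3,4) stage_0 by simp
    moreover have "unserialize G g' @ [(a, w')] \<in> histories G"
      using snoc.prems g'(3) e by simp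
    ultimately obtain g'' where "g'' \<in> histories (serialize G)" "prefix g' g''"
      "unserialize G g'' = unserialize G g' @ [(a, w')]"
      "last_state (serialize G) g'' = entry_state G w'"
      using serial_snoc[OF g'(1), of 0 a w'] by blast
    with g'(2,3) e show ?case
      by (intro exI[of _ g'']) (simp add: prefix_order.trans[of g g' g''] flip: append_assoc)
  qed
  then show ?thesis using that by blast
qed

lemma serial_exists:
  assumes "h \<in> histories G"
  obtains g where "g \<in> histories (serialize G)" "unserialize G g = h"
    "last_state (serialize G) g = entry_state G (last_state G h)"
  using serial_extend[of "[]" h] assms that by (auto simp: histories.empty)

lemma serial_node_exists:
  assumes h: "h \<in> acts_in G i" and b: "b \<in> partial_legal G (last_state G h) i"
  obtains g where "g \<in> acts_in (serialize G) i" "unserialize G g = h"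
    "last_state (serialize G) g = Decide (last_state G h) i b"
proof -
  let ?w = "last_state G h"
  have h': "h \<in> histories G" "i \<in> active G ?w" using h by (simp_all add: acts_in_def)
  have w: "?w \<in> states G" using last_state_states[OF h'(1)] .
  \<comment> \<open>b is completed by arbitrary legal actions of the active players from i on, so
    that the node sought is stage i of the round with joint action a.\<close>
  define a where "a = (\<lambda>j. if j \<in> active G ?w then
    (if j < i then b j else Some (SOME x. x \<in> legal G j ?w)) else None)"
  have "(SOME x. x \<in> legal G j ?w) \<in> legal G j ?w" if "j \<in> active G ?w" for j
    using legal_nonempty[OF w that] by (simp add: some_in_eq)
  then have "a j \<in> Some ` legal G j ?w" if "j \<in> active G ?w" for j
    using b that by (simp add: a_def partial_legal_def)
  moreover have "a j = None" if "j \<notin> active G ?w" for j using that by (simp add: a_def)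
  ultimately have a: "a \<in> joint_legal G ?w"
    using active_subset[OF w] by (auto simp: joint_legal_def moves_def)
  have cut: "cut i a = b"
    using b by (auto simp: cut_def a_def partial_legal_def fun_eq_iff)
  from serial_exists[OF h'(1)] obtain g where g: "g \<in> histories (serialize G)"
    "unserialize G g = h" "last_state (serialize G) g = stage ?w 0 a"
    unfolding stage_0 by blast
  from le0[of i] g(1,3) w a obtain g' where g': "g' \<in> histories (serialize G)"
    "unserialize G g' = unserialize G g" "last_state (serialize G) g' = stage ?w i a"
    by (rule stage_reach)
  have "last_state (serialize G) g' = Decide ?w i b"
    using g'(3) stage_active[OF w h'(2)] cut by simp
  with that[of g'] g' g(2) show ?thesis by (simp add: acts_in_serial)
qed

text \<open>Here the node of i has to lie on the way to the lift of the longer history, so the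
  earlier choices must be those of the joint action in e.\<close>

lemma serial_path_exists:
  assumes h: "h \<in> acts_in G i" and z: "h @ e # r \<in> histories G"
  obtains g g' where "g \<in> acts_in (serialize G) i" "unserialize G g = h"
    "g' \<in> histories (serialize G)" "prefix g g'" "unserialize G g' = h @ e # r"
    "last_state (serialize G) g' = entry_state G (last_state G (h @ e # r))"
proof -
  let ?w = "last_state G h"
  obtain a w' where e: "e = (a, w')" by (cases e)
  have h': "h \<in> histories G" "i \<in> active G ?w" using h by (simp_all add: acts_in_def)
  have w: "?w \<in> states G" using last_state_states[OF h'(1)] .
  have hist: "h @ [(a, w')] \<in> histories G"
    using histories_appendD[of "h @ [e]" r G] z e by simp
  then have a: "a \<in> joint_legal G ?w" by (rule histories_snocD) simp
  from serial_exists[OF h'(1)] obtain g0 where g0: "g0 \<in> histories (serialize G)"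
    "unserialize G g0 = h" "last_state (serialize G) g0 = stage ?w 0 a"
    unfolding stage_0 by blast
  from le0[of i] g0(1,3) w a obtain g where g: "g \<in> histories (serialize G)"
    "unserialize G g = unserialize G g0" "last_state (serialize G) g = stage ?w i a"
    by (rule stage_reach)
  have acts: "g \<in> acts_in (serialize G) i"
    using g stage_active[OF w h'(2)] by (simp add: acts_in_serial)
  have "i \<le> Suc (nplayers G)" using active_subset[OF w h'(2)] by (simp add: players_def)
  with g hist g0(2) obtain g1 where g1: "g1 \<in> histories (serialize G)" "prefix g g1"
    "unserialize G g1 = h @ [e]" "last_state (serialize G) g1 = entry_state G w'"
    using serial_snoc[of g i a w'] e by auto
  then have "last_state (serialize G) g1 = entry_state G (last_state G (unserialize G g1))"
    using e by simp
  moreover have "unserialize G g1 @ r \<in> histories G" using z g1(3) by simp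
  ultimately obtain g2 where "g2 \<in> histories (serialize G)" "prefix g1 g2"
    "unserialize G g2 = h @ e # r"
    "last_state (serialize G) g2 = entry_state G (last_state G (h @ e # r))"
    using serial_extend[OF g1(1), of r] g1(3) by auto
  with that[OF acts] g(2) g0(2) prefix_order.trans[OF g1(2)] show ?thesis by simp
qed

text \<open>
  The predecessor is determined by the reached state: only a resolving step leads to a state where
  nothing has been chosen, and otherwise the last chooser is the greatest player with a choice.
\<close>

lemma serial_history_unique:
  assumes "g \<in> histories (serialize G)" "g' \<in> histories (serialize G)"
    "unserialize G g = unserialize G g'"
    "last_state (serialize G) g = last_state (serialize G) g'"
  shows "g = g'"
  using assms
proof (induction g arbitrary: g' rule: serial_induct)
  case empty
  have "chosen (last_state (serialize G) g') = noops"
    using empty(3)[symmetric] by simp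
  with empty(1) show ?case
  proof (cases rule: serial_cases)
    case (Decide g2 w2 i2 b2 x2)
    then have "chosen (last_state (serialize G) g') i2 \<noteq> None" by simp
    then show ?thesis using \<open>chosen (last_state (serialize G) g') = noops\<close> by simp
  next
    case (Resolve g2 w2 a2 w2' D2)
    then show ?thesis using empty(2) by simp
  qed simp
next
  case (Decide g w i b x)
  define c where "c = b(i := Some x)"
  have c: "chosen (last_state (serialize G) g') = c"
    using Decide.prems(3)[symmetric] by (simp add: c_def)
  then have "chosen (last_state (serialize G) g') i \<noteq> None" by (simp add: c_def)
  with Decide.prems(1) show ?case
  proof (cases rule: serial_cases)
    case (Decide g2 w2 i2 b2 x2)
    have uns: "unserialize G g = unserialize G g2"
      using Decide.prems(2) Decide.hyps(2) Decide(1,3) by simp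
    have c2: "c = b2(i2 := Some x2)" using c Decide(1) by simp
    have "j \<le> i" if "c j \<noteq> None" for j
      using that partial_legal_less[OF Decide.hyps(5), of j]
      unfolding c_def by (cases "j = i") simp_all
    moreover have "j \<le> i2" if "c j \<noteq> None" for j
      using that partial_legal_less[OF Decide(6), of j]
      unfolding c2 by (cases "j = i2") simp_all
    moreover have "c i \<noteq> None" "c i2 \<noteq> None" by (simp add: c_def, simp add: c2)
    ultimately have i: "i2 = i" by (meson le_antisym)
    have "b i = None" "b2 i = None"
      using Decide.hyps(5) Decide(6) i by (simp_all add: partial_legal_def)
    then have "b = c(i := None)" unfolding c_def by (simp add: fun_eq_iff)
    moreover have "b2 = c(i := None)" unfolding c2 i using \<open>b2 i = None\<close> by (simp add: fun_eq_iff)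
    ultimately have b: "b2 = b" by simp
    have x: "x2 = x" using fun_cong[OF c2, of i] by (simp add: c_def i)
    have w: "w2 = w" using uns Decide(4) Decide.hyps(3) by simp
    have "g = g2"
      using Decide.IH[OF Decide(2) uns] Decide(3) Decide.hyps(2) by (simp add: i b w)
    then show ?thesis unfolding Decide(1) by (simp add: i b w x)
  qed simp_all
next
  case (Resolve g w a w' D)
  have "chosen (last_state (serialize G) g') = noops"
    using Resolve.prems(3)[symmetric] by simp
  with Resolve.prems(1) show ?case
  proof (cases rule: serial_cases)
    case empty
    then show ?thesis using Resolve.prems(2) Resolve.hyps(2) by simp
  next
    case (Decide g2 w2 i2 b2 x2)
    then have "chosen (last_state (serialize G) g') i2 \<noteq> None" by simp
    then show ?thesis using \<open>chosen (last_state (serialize G) g') = noops\<close> by simp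
  next
    case (Resolve g2 w2 a2 w2' D2)
    have uns: "unserialize G g = unserialize G g2" "a2 = a" "w2' = w'"
      using Resolve.prems(2) Resolve.hyps(2) Resolve(1,3) by simp_all
    then have w: "w2 = w" using Resolve(4) Resolve.hyps(3) by simp
    have "g = g2"
      using Resolve.IH[OF Resolve(2) uns(1)] Resolve(3) Resolve.hyps(2) by (simp add: uns w)
    then show ?thesis unfolding Resolve(1) by (simp add: uns)
  qed
qed

section \<open>Terminal histories of the two games\<close>

lemma terminal_entry_state: "terminal G w \<Longrightarrow> terminal (serialize G) (entry_state G w)"
  by (simp add: terminal_def entry_state_def)

text \<open>A terminal serialized state is a \<open>Resolve\<close> state whose original transition
  is undefined. By \<open>trans_defined\<close> nobody is active there, so the joint action consists
  of noops.\<close>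

lemma serial_terminalD:
  assumes "z \<in> terminal_histories (serialize G)"
  shows "unserialize G z \<in> terminal_histories G"
    and "last_state (serialize G) z = entry_state G (last_state G (unserialize G z))"
    and "chosen (last_state (serialize G) z) = noops"
proof -
  let ?w = "last_state G (unserialize G z)"
  have z: "z \<in> histories (serialize G)" "terminal (serialize G) (last_state (serialize G) z)"
    using assms by (simp_all add: terminal_histories_def)
  note inv = serial_history[OF z(1)]
  have w: "?w \<in> states G" using last_state_states[OF inv(1)] .
  have "\<exists>a. last_state (serialize G) z = Resolve ?w a"
    using z(2) inv(2) by (cases "last_state (serialize G) z") (simp_all add: terminal_def)
  then obtain a where a: "last_state (serialize G) z = Resolve ?w a" by blast
  then have al: "a \<in> joint_legal G ?w" and none: "trans G ?w a = None"
    using inv(3) z(2) by (simp_all add: terminal_def)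
  have act: "active G ?w = {}" using trans_defined[OF w _ al] none by blast
  then have "a = noops" using joint_legalD(2)[OF w al] by auto
  with act none a show "last_state (serialize G) z = entry_state G ?w"
    "chosen (last_state (serialize G) z) = noops" "unserialize G z \<in> terminal_histories G"
    using inv(1) by (simp_all add: entry_state_def terminal_histories_def terminal_def)
qed

text \<open>With nothing pending, the last state is a function of the unserialized history, and then
  the two determine the serialized one.\<close>

lemma inj_on_unserialize_terminal: "inj_on (unserialize G) (terminal_histories (serialize G))"
proof (rule inj_onI)
  fix z z' assume z: "z \<in> terminal_histories (serialize G)" "z' \<in> terminal_histories (serialize G)"
    "unserialize G z = unserialize G z'"
  then have "last_state (serialize G) z = last_state (serialize G) z'"
    using serial_terminalD(2) by simp
  with z show "z = z'"
    using serial_history_unique unfolding terminal_histories_def by blast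
qed

end

section \<open>Reach probabilities in the extensive-form game\<close>

lemma classical_efg_simps [simp]:
  "efg_players (classical_efg G) = players G"
  "tree (classical_efg G) = histories (serialize G)"
  "leaves (classical_efg G) = terminal_histories (serialize G)"
  "utility (classical_efg G) i z = cum_reward (serialize G) i z"
  "chance_prob (classical_efg G) g e = trans_prob (serialize G) (last_state (serialize G) g) (fst e) (snd e)"
  "infosets (classical_efg G) i =
     {{g' \<in> acts_in (serialize G) i. serial_info_state G i g' = serial_info_state G i g} |g.
        g \<in> acts_in (serialize G) i}"
  by (simp_all add: classical_efg_def Let_def)

lemma actor_simps:
  "last_state (serialize G) g = Decide w i b \<Longrightarrow> actor (classical_efg G) g = Some i"
  "last_state (serialize G) g = Resolve w a \<Longrightarrow> actor (classical_efg G) g = None"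
  by (simp_all add: classical_efg_def Let_def)

lemma edge_action_simp:
  "last_state (serialize G) g = Decide w i b \<Longrightarrow> edge_action (classical_efg G) g e = the (fst e i)"
  by (simp add: classical_efg_def Let_def)

lemma actor_eq_Some:
  "actor (classical_efg G) g = Some i \<longleftrightarrow> (\<exists>w b. last_state (serialize G) g = Decide w i b)"
  by (cases "last_state (serialize G) g") (simp_all add: actor_simps)

lemma efg_chance_reach_Nil [simp]: "efg_chance_reach E 0 [] = 1"
  by (simp add: efg_chance_reach_def)

text \<open>Factors 1 in place of a filtered index set let the product split at a prefix.\<close>

lemma efg_chance_reach_if: "efg_chance_reach E m h = (\<Prod>k\<in>{m..<length h}.
    if actor E (take k h) = None then chance_prob E (take k h) (h ! k) else 1)"
  unfolding efg_chance_reach_def by (rule prod.inter_filter) simp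

lemma efg_chance_reach_append:
  "efg_chance_reach E 0 (h @ r) = efg_chance_reach E 0 h * efg_chance_reach E (length h) (h @ r)"
proof -
  let ?f = "\<lambda>h k. if actor E (take k h) = None then chance_prob E (take k h) (h ! k) else 1"
  have "efg_chance_reach E 0 (h @ r) =
      (\<Prod>k\<in>{0..<length h}. ?f (h @ r) k) * efg_chance_reach E (length h) (h @ r)"
    unfolding efg_chance_reach_if by (subst prod.atLeastLessThan_concat) auto
  also have "(\<Prod>k\<in>{0..<length h}. ?f (h @ r) k) = efg_chance_reach E 0 h"
    unfolding efg_chance_reach_if by (intro prod.cong) (simp_all add: nth_append)
  finally show ?thesis .
qed

lemma efg_chance_reach_snoc:
  "efg_chance_reach E 0 (h @ [e]) =
   efg_chance_reach E 0 h * (if actor E h = None then chance_prob E h e else 1)"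
  unfolding efg_chance_reach_append[of E h]
  by (cases "actor E h") (simp_all add: efg_chance_reach_if[of E "length h"])

text \<open>The reach probability in the serialized tree of a policy of the original game. It can be
  evaluated at \<open>follow\<close> profiles without constructing their counterparts on information
  sets.\<close>

definition serial_reach ::
    "('w, 'a, 'o) fosg \<Rightarrow> ('a, ('a, 'o) entry list) profile \<Rightarrow> nat \<Rightarrow> nat \<Rightarrow>
     (('w, 'a) sstate, 'a) history \<Rightarrow> real" where
  "serial_reach G \<pi> j m g = (\<Prod>k\<in>{m..<length g}. if actor (classical_efg G) (take k g) = Some j
     then \<pi> j (info_state G j (unserialize G (take k g)))
       (edge_action (classical_efg G) (take k g) (g ! k)) else 1)"

lemma serial_reach_Nil [simp]: "serial_reach G \<pi> j m [] = 1"
  by (simp add: serial_reach_def)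

lemma serial_reach_append:
  "serial_reach G \<pi> j 0 (h @ r) = serial_reach G \<pi> j 0 h * serial_reach G \<pi> j (length h) (h @ r)"
proof -
  let ?f = "\<lambda>g k. if actor (classical_efg G) (take k g) = Some j
     then \<pi> j (info_state G j (unserialize G (take k g)))
       (edge_action (classical_efg G) (take k g) (g ! k)) else 1"
  have "serial_reach G \<pi> j 0 (h @ r) =
      (\<Prod>k\<in>{0..<length h}. ?f (h @ r) k) * serial_reach G \<pi> j (length h) (h @ r)"
    unfolding serial_reach_def by (subst prod.atLeastLessThan_concat) auto
  also have "(\<Prod>k\<in>{0..<length h}. ?f (h @ r) k) = serial_reach G \<pi> j 0 h"
    unfolding serial_reach_def by (intro prod.cong) (simp_all add: nth_append)
  finally show ?thesis .
qed

lemma serial_reach_snoc: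
  "serial_reach G \<pi> j 0 (h @ [e]) = serial_reach G \<pi> j 0 h *
     (if actor (classical_efg G) h = Some j
      then \<pi> j (info_state G j (unserialize G h)) (edge_action (classical_efg G) h e) else 1)"
  unfolding serial_reach_append[of G \<pi> j h] by (simp add: serial_reach_def[of G \<pi> j "length h"])

context FOSG_cfr
begin

text \<open>Decision nodes are not chance nodes and contribute no factor; a resolving step
  contributes the probability of the original transition.\<close>

lemma efg_chance_reach_unserialize:
  "g \<in> histories (serialize G) \<Longrightarrow>
   efg_chance_reach (classical_efg G) 0 g = chance_reach G 0 (unserialize G g)"
proof (induction g rule: serial_induct)
  case (Decide g w i b x)
  then show ?case by (simp add: efg_chance_reach_snoc actor_simps)
next
  case (Resolve g w a w' D)
  then have "trans_prob (serialize G) (Resolve w a) noops (entry_state G w') = trans_prob G w a w'"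
    by (simp add: trans_prob_def pmf_map_inj' entry_state_injective)
  with Resolve show ?case by (simp add: efg_chance_reach_snoc actor_simps)
qed simp

text \<open>A choice already made in the current round is not yet visible in the original history.\<close>

lemma serial_reach_unserialize:
  "g \<in> histories (serialize G) \<Longrightarrow>
   serial_reach G \<pi> j 0 g = player_reach G \<pi> j 0 (unserialize G g) *
     (case chosen (last_state (serialize G) g) j of None \<Rightarrow> 1
      | Some x \<Rightarrow> \<pi> j (info_state G j (unserialize G g)) x)"
proof (induction g rule: serial_induct)
  case (Decide g w i b x)
  then have "b i = None" by (simp add: partial_legal_def)
  with Decide show ?case
    by (cases "j = i")
      (simp_all add: serial_reach_snoc actor_simps edge_action_simp cong: option.case_cong)
next
  case (Resolve g w a w' D)
  then show ?case by (simp add: serial_reach_snoc actor_simps)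
qed simp

lemma infoset_mapD:
  assumes "g \<in> infoset_map G i s"
  obtains b where "g \<in> histories (serialize G)" "unserialize G g \<in> acts_in G i"
    "info_state G i (unserialize G g) = s"
    "last_state (serialize G) g = Decide (last_state G (unserialize G g)) i b"
    "b \<in> partial_legal G (last_state G (unserialize G g)) i" "b i = None"
  using assms by (auto simp: infoset_map_def elim: acts_in_serialD)

lemma serial_reach_follow:
  assumes "g \<in> infoset_map G i s"
  shows "serial_reach G (follow \<pi> i (s @ t)) i 0 g = 1"
proof -
  from assms obtain b where g: "g \<in> histories (serialize G)" "info_state G i (unserialize G g) = s"
    "last_state (serialize G) g = Decide (last_state G (unserialize G g)) i b" "b i = None"
    by (rule infoset_mapD)
  have "serial_reach G (follow \<pi> i (s @ t)) i 0 g = player_reach G (follow \<pi> i (s @ t)) i 0 (unserialize G g)"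
    using serial_reach_unserialize[OF g(1)] g(3,4) by simp
  then show ?thesis unfolding g(2)[symmetric] player_reach_follow .
qed

lemma info_state_serial_beyond:
  assumes "g \<in> infoset_map G i s" "length g \<le> k"
  obtains t where "info_state G i (unserialize G (take k (g @ r))) = s @ t"
proof -
  have "take k (g @ r) = g @ take (k - length g) r" using assms(2) by simp
  then obtain r' where "unserialize G (take k (g @ r)) = unserialize G g @ r'"
    by (metis unserialize_append)
  then obtain t where "info_state G i (unserialize G (take k (g @ r))) =
      info_state G i (unserialize G g) @ t"
    by (metis info_state_append)
  with that assms(1) show ?thesis by (simp add: infoset_map_def)
qed

lemma serial_reach_follow_beyond:
  assumes "g \<in> infoset_map G i s"
  shows "serial_reach G (follow \<pi> i s) i (length g) (g @ r) = serial_reach G \<pi> i (length g) (g @ r)"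
  unfolding serial_reach_def
proof (rule prod.cong[OF refl])
  fix k assume "k \<in> {length g..<length (g @ r)}"
  then have "length g \<le> k" by simp
  with assms obtain t where "info_state G i (unserialize G (take k (g @ r))) = s @ t"
    by (rule info_state_serial_beyond)
  then have "follow \<pi> i s i (info_state G i (unserialize G (take k (g @ r)))) =
      \<pi> i (info_state G i (unserialize G (take k (g @ r))))"
    by (simp add: follow_beyond del: take_append)
  then show "(if actor (classical_efg G) (take k (g @ r)) = Some i
     then follow \<pi> i s i (info_state G i (unserialize G (take k (g @ r))))
       (edge_action (classical_efg G) (take k (g @ r)) ((g @ r) ! k)) else 1) =
    (if actor (classical_efg G) (take k (g @ r)) = Some i
     then \<pi> i (info_state G i (unserialize G (take k (g @ r))))
       (edge_action (classical_efg G) (take k (g @ r)) ((g @ r) ! k)) else 1)"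
    by simp
qed

lemma serial_reach_follow_Act:
  assumes g: "g \<in> infoset_map G i s" and z: "g @ e # r \<in> histories (serialize G)"
  shows "serial_reach G (follow \<pi> i (s @ [Act x])) i (length g) (g @ e # r) =
    (if edge_action (classical_efg G) g e = x
     then serial_reach G \<pi> i (Suc (length g)) (g @ e # r) else 0)"
proof -
  let ?f = "follow \<pi> i (s @ [Act x])" and ?z = "g @ e # r"
  have "serial_reach G ?f i (Suc (length g)) ?z = serial_reach G \<pi> i (Suc (length g)) ?z"
    unfolding serial_reach_def
  proof (rule prod.cong[OF refl])
    fix k assume k: "k \<in> {Suc (length g)..<length ?z}"
    have "?f i (info_state G i (unserialize G (take k ?z))) =
        \<pi> i (info_state G i (unserialize G (take k ?z)))"
      if "actor (classical_efg G) (take k ?z) = Some i"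
    proof -
      have "length g \<le> k" using k by simp
      with g obtain t where t: "info_state G i (unserialize G (take k ?z)) = s @ t"
        by (rule info_state_serial_beyond)
      \<comment> \<open>Otherwise the path to z would meet a second node of the same information
        set, contrary to the antichain property.\<close>
      have "t \<noteq> []"
      proof
        assume "t = []"
        then have "take k ?z \<in> infoset_map G i s"
          using t that histories_take[OF z, of k]
          by (simp add: infoset_map_def acts_in_serial actor_eq_Some del: take_append)
        with g have "g = take k ?z"
          by (rule infoset_map_antichain[where z = ?z]) (simp, rule take_is_prefix)
        then have "length g = length (take k ?z)" by simp
        then show False using k by (auto simp: min_def split: if_splits)
      qed
      then show ?thesis unfolding t by (rule follow_snoc_beyond)
    qed
    then show "(if actor (classical_efg G) (take k ?z) = Some i
       then ?f i (info_state G i (unserialize G (take k ?z)))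
         (edge_action (classical_efg G) (take k ?z) (?z ! k)) else 1) =
      (if actor (classical_efg G) (take k ?z) = Some i
       then \<pi> i (info_state G i (unserialize G (take k ?z)))
         (edge_action (classical_efg G) (take k ?z) (?z ! k)) else 1)"
      by simp
  qed
  moreover have "actor (classical_efg G) g = Some i" "info_state G i (unserialize G g) = s"
    using g by (auto simp: infoset_map_def acts_in_serial actor_eq_Some)
  then have "serial_reach G ?f i (length g) ?z =
      (if edge_action (classical_efg G) g e = x then 1 else 0) * serial_reach G ?f i (Suc (length g)) ?z"
    unfolding serial_reach_def by (subst prod.atLeast_Suc_lessThan) auto
  ultimately show ?thesis by simp
qed

section \<open>Corresponding profiles\<close>

lemma infoset_eq:
  assumes "g \<in> acts_in (serialize G) i"
  shows "{g' \<in> acts_in (serialize G) i. serial_info_state G i g' = serial_info_state G i g} =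
    infoset_map G i (info_state G i (unserialize G g))"
  unfolding infoset_map_def using serial_info_state_eq_iff[OF _ assms] by blast

lemma acting_info_states_serial:
  "acting_info_states G i = (\<lambda>g. info_state G i (unserialize G g)) ` acts_in (serialize G) i"
proof (intro equalityI subsetI)
  fix s assume "s \<in> acting_info_states G i"
  then obtain h where h: "h \<in> acts_in G i" "s = info_state G i h"
    by (auto simp: acting_info_states_def)
  then have "h \<in> histories G" by (simp add: acts_in_def)
  then obtain g where g: "g \<in> histories (serialize G)" "unserialize G g = h"
    "last_state (serialize G) g = entry_state G (last_state G h)"
    by (rule serial_exists)
  let ?w = "last_state G h"
  have w: "?w \<in> states G" "i \<in> active G ?w"
    using h(1) last_state_states by (simp_all add: acts_in_def)
  \<comment> \<open>Any legal joint action will do: it only serves to lead the round up to the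
    decision of i.\<close>
  obtain a where a: "a \<in> joint_legal G ?w"
  proof
    show "(\<lambda>j. if j \<in> active G ?w then Some (SOME x. x \<in> legal G j ?w) else None) \<in> joint_legal G ?w"
      using legal_nonempty[OF w(1)] active_subset[OF w(1)]
      by (auto simp: joint_legal_def moves_def some_in_eq)
  qed
  from g(3) have "last_state (serialize G) g = stage ?w 0 a" by (simp add: stage_0)
  from le0[of i] g(1) this w(1) a obtain g' where "g' \<in> histories (serialize G)"
    "unserialize G g' = unserialize G g" "last_state (serialize G) g' = stage ?w i a"
    by (rule stage_reach)
  then have "g' \<in> acts_in (serialize G) i" "s = info_state G i (unserialize G g')"
    using g(2) h(2) stage_active[OF w] by (simp_all add: acts_in_serial)
  then show "s \<in> (\<lambda>g. info_state G i (unserialize G g)) ` acts_in (serialize G) i" by blast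
next
  fix s assume "s \<in> (\<lambda>g. info_state G i (unserialize G g)) ` acts_in (serialize G) i"
  then obtain g where g: "g \<in> acts_in (serialize G) i" "s = info_state G i (unserialize G g)" by blast
  from g(1) have "unserialize G g \<in> acts_in G i" by (rule acts_in_serialD)
  with g(2) show "s \<in> acting_info_states G i" by (simp add: acting_info_states_def)
qed

lemma infosets_eq: "infosets (classical_efg G) i = infoset_map G i ` acting_info_states G i"
proof -
  have "infosets (classical_efg G) i =
      (\<lambda>g. infoset_map G i (info_state G i (unserialize G g))) ` acts_in (serialize G) i"
    using infoset_eq[of _ i] by (auto simp: image_def)
  then show ?thesis unfolding acting_info_states_serial by (simp add: image_image)
qed

lemma inj_on_infoset_map: "inj_on (infoset_map G i) (acting_info_states G i)"
proof (rule inj_onI)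
  fix s s' assume s: "s \<in> acting_info_states G i" and eq: "infoset_map G i s = infoset_map G i s'"
  from s obtain g where "g \<in> infoset_map G i s"
    unfolding acting_info_states_serial infoset_map_def by blast
  moreover from this have "g \<in> infoset_map G i s'" using eq by simp
  ultimately show "s = s'" by (simp add: infoset_map_def)
qed

lemma infoset_of_eq:
  assumes "g \<in> acts_in (serialize G) i"
  shows "infoset_of (classical_efg G) i g = infoset_map G i (info_state G i (unserialize G g))"
  unfolding infoset_of_def
proof (rule the_equality)
  show "infoset_map G i (info_state G i (unserialize G g)) \<in> infosets (classical_efg G) i \<and>
      g \<in> infoset_map G i (info_state G i (unserialize G g))"
    unfolding infosets_eq acting_info_states_serial using assms by (auto simp: infoset_map_def)
next
  fix I assume "I \<in> infosets (classical_efg G) i \<and> g \<in> I"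
  then obtain s where "I = infoset_map G i s" "g \<in> infoset_map G i s"
    unfolding infosets_eq by blast
  then show "I = infoset_map G i (info_state G i (unserialize G g))"
    by (simp add: infoset_map_def)
qed

text \<open>Only information states at which the player acts matter, since reach probabilities
  consult the policies there.\<close>

definition corresponds ::
    "('a, ('a, 'o) entry list) profile \<Rightarrow> ('a, (('w, 'a) sstate, 'a) history set) profile \<Rightarrow> bool" where
  "corresponds \<pi> \<sigma> \<longleftrightarrow>
     (\<forall>i\<in>players G. \<forall>s\<in>acting_info_states G i. \<sigma> i (infoset_map G i s) = \<pi> i s)"

lemma efg_player_reach_eq:
  assumes "corresponds \<pi> \<sigma>" "j \<in> players G" "g \<in> histories (serialize G)"
  shows "efg_player_reach (classical_efg G) \<sigma> j m g = serial_reach G \<pi> j m g"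
proof -
  have "efg_player_reach (classical_efg G) \<sigma> j m g =
      (\<Prod>k\<in>{m..<length g}. if actor (classical_efg G) (take k g) = Some j
        then \<sigma> j (infoset_of (classical_efg G) j (take k g))
          (edge_action (classical_efg G) (take k g) (g ! k)) else 1)"
    unfolding efg_player_reach_def by (rule prod.inter_filter) simp
  also have "\<dots> = serial_reach G \<pi> j m g"
    unfolding serial_reach_def
  proof (rule prod.cong[OF refl])
    fix k assume "k \<in> {m..<length g}"
    have "\<sigma> j (infoset_of (classical_efg G) j (take k g)) =
        \<pi> j (info_state G j (unserialize G (take k g)))"
      if "actor (classical_efg G) (take k g) = Some j"
    proof -
      have "take k g \<in> acts_in (serialize G) j"
        using that histories_take[OF assms(3)] by (simp add: acts_in_serial actor_eq_Some)
      moreover from this have "info_state G j (unserialize G (take k g)) \<in> acting_info_states G j"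
        unfolding acting_info_states_serial by (rule imageI)
      ultimately show ?thesis
        using assms(1,2) by (simp add: infoset_of_eq corresponds_def)
    qed
    then show "(if actor (classical_efg G) (take k g) = Some j
        then \<sigma> j (infoset_of (classical_efg G) j (take k g))
          (edge_action (classical_efg G) (take k g) (g ! k)) else 1) =
      (if actor (classical_efg G) (take k g) = Some j
       then \<pi> j (info_state G j (unserialize G (take k g)))
         (edge_action (classical_efg G) (take k g) (g ! k)) else 1)"
      by simp
  qed
  finally show ?thesis .
qed

lemma efg_others_reach_eq:
  assumes "corresponds \<pi> \<sigma>" "g \<in> histories (serialize G)"
  shows "efg_others_reach (classical_efg G) \<sigma> i m g =
    efg_chance_reach (classical_efg G) m g * (\<Prod>j\<in>players G - {i}. serial_reach G \<pi> j m g)"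
  unfolding efg_others_reach_def classical_efg_simps
  by (intro arg_cong2[where f = times] refl prod.cong efg_player_reach_eq[OF assms(1) _ assms(2)])
    simp

lemma efg_reach_others:
  assumes "corresponds \<pi> \<sigma>" "g \<in> histories (serialize G)" "i \<in> players G"
  shows "efg_reach (classical_efg G) \<sigma> m g =
    efg_others_reach (classical_efg G) \<sigma> i m g * serial_reach G \<pi> i m g"
  using assms(3) efg_player_reach_eq[OF assms(1,3,2)]
  by (simp add: efg_reach_def efg_others_reach_def prod.remove)

lemma efg_others_reach_append:
  assumes "corresponds \<pi> \<sigma>" "g @ r \<in> histories (serialize G)"
  shows "efg_others_reach (classical_efg G) \<sigma> i 0 (g @ r) =
    efg_others_reach (classical_efg G) \<sigma> i 0 g * efg_others_reach (classical_efg G) \<sigma> i (length g) (g @ r)"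
  unfolding efg_others_reach_eq[OF assms] efg_others_reach_eq[OF assms(1) histories_appendD[OF assms(2)]]
    efg_chance_reach_append[of _ g r] serial_reach_append[of G \<pi> _ g r] prod.distrib
  by (simp only: ac_simps)

lemma efg_others_reach_unserialize:
  assumes "corresponds \<pi> \<sigma>" "g \<in> histories (serialize G)"
  shows "efg_others_reach (classical_efg G) \<sigma> i 0 g = others_reach G \<pi> i 0 (unserialize G g) *
    (\<Prod>j\<in>players G - {i}. case chosen (last_state (serialize G) g) j of None \<Rightarrow> 1
      | Some x \<Rightarrow> \<pi> j (info_state G j (unserialize G g)) x)"
  unfolding efg_others_reach_eq[OF assms] efg_chance_reach_unserialize[OF assms(2)]
    serial_reach_unserialize[OF assms(2)] prod.distrib others_reach_def
  by (simp only: ac_simps)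

text \<open>The forced own factor up to g is 1 and can be inserted, after which the products split
  at g close up to products over z. At a leaf no choice is pending, so these equal the reach of the
  unserialized history.\<close>

lemma leaf_reach:
  assumes \<sigma>: "corresponds \<pi> \<sigma>" and i: "i \<in> players G" and g: "g \<in> infoset_map G i s"
    and z: "z \<in> terminal_histories (serialize G)" "prefix g z"
  shows "efg_others_reach (classical_efg G) \<sigma> i 0 g *
      (efg_others_reach (classical_efg G) \<sigma> i (length g) z *
       serial_reach G (follow \<pi> i (s @ t)) i (length g) z) =
    reach G (follow \<pi> i (s @ t)) 0 (unserialize G z)"
proof -
  let ?f = "follow \<pi> i (s @ t)"
  from z(2) obtain r where r: "z = g @ r" by (rule prefixE)
  have zh: "z \<in> histories (serialize G)" using z(1) by (simp add: terminal_histories_def)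
  have "efg_others_reach (classical_efg G) \<sigma> i 0 g *
      (efg_others_reach (classical_efg G) \<sigma> i (length g) z * serial_reach G ?f i (length g) z) =
    efg_others_reach (classical_efg G) \<sigma> i 0 z * (serial_reach G ?f i 0 g * serial_reach G ?f i (length g) z)"
    using efg_others_reach_append[OF \<sigma>, of g r i] zh serial_reach_follow[OF g] by (simp add: r)
  also have "serial_reach G ?f i 0 g * serial_reach G ?f i (length g) z = serial_reach G ?f i 0 z"
    unfolding r by (rule serial_reach_append[symmetric])
  also have "\<dots> = player_reach G ?f i 0 (unserialize G z)"
    using serial_reach_unserialize[OF zh] serial_terminalD(3)[OF z(1)] by simp
  also have "efg_others_reach (classical_efg G) \<sigma> i 0 z = others_reach G ?f i 0 (unserialize G z)"
    using efg_others_reach_unserialize[OF \<sigma> zh] serial_terminalD(3)[OF z(1)] by simp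
  finally show ?thesis by (simp add: reach_others[OF i])
qed

end

section \<open>Counterfactual values in the extensive-form game\<close>

context FOSG_cfr
begin

text \<open>The active players before i choose independently, each by a probability distribution, so
  their joint choices have total probability 1. Encoding partial joint actions as functions in
  \<open>?F\<close> turns the sum of products into a product of sums.\<close>

lemma
  assumes \<pi>: "is_profile G \<pi>" and h: "h \<in> histories G"
  defines "w \<equiv> last_state G h"
  shows finite_partial_legal: "finite (partial_legal G w i)"
    and sum_partial_legal: "(\<Sum>b\<in>partial_legal G w i. \<Prod>j\<in>players G - {i}.
        case b j of None \<Rightarrow> 1 | Some x \<Rightarrow> \<pi> j (info_state G j h) x) = 1"
proof -
  define J where "J = {j \<in> active G w. j < i}"
  define m where "m = (\<lambda>f j. if j \<in> J then Some (f j :: 'a) else None)"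
  let ?F = "PiE J (\<lambda>j. legal G j w)"
  let ?p = "\<lambda>b j. case b j of None \<Rightarrow> 1 | Some x \<Rightarrow> \<pi> j (info_state G j h) x"
  have w: "w \<in> states G" unfolding w_def using h by (rule last_state_states)
  have J: "J \<subseteq> players G - {i}" using active_subset[OF w] by (auto simp: J_def)
  then have finJ: "finite J" by (rule finite_subset) simp
  have finL: "finite (legal G j w)" if "j \<in> J" for j
    using that finite_legal[OF w] by (simp add: J_def)
  have partial: "partial_legal G w i = m ` ?F"
  proof (intro equalityI subsetI)
    fix b assume b: "b \<in> partial_legal G w i"
    have "b j \<in> Some ` legal G j w" if "j \<in> J" for j
      using b that by (simp add: partial_legal_def J_def)
    moreover have "b j = None" if "j \<notin> J" for j
      using b that by (simp add: partial_legal_def J_def)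
    ultimately have "b = m (restrict (\<lambda>j. the (b j)) J)" "restrict (\<lambda>j. the (b j)) J \<in> ?F"
      by (force simp: m_def)+
    then show "b \<in> m ` ?F" by blast
  next
    fix b assume "b \<in> m ` ?F"
    then show "b \<in> partial_legal G w i"
      by (auto simp: m_def J_def partial_legal_def PiE_def)
  qed
  have inj: "inj_on m ?F"
  proof (rule inj_onI)
    fix f f' assume f: "f \<in> ?F" "f' \<in> ?F" and eq: "m f = m f'"
    show "f = f'"
      using f
    proof (rule PiE_ext)
      fix j assume "j \<in> J"
      then show "f j = f' j" using fun_cong[OF eq, of j] by (simp add: m_def)
    qed
  qed
  show "finite (partial_legal G w i)"
    unfolding partial using finJ finL by (intro finite_imageI finite_PiE)
  have one: "(\<Sum>x\<in>legal G j w. \<pi> j (info_state G j h) x) = 1" if "j \<in> J" for j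
  proof -
    have "h \<in> acts_in G j" using h that by (simp add: acts_in_def J_def w_def)
    then have "legal_at G j (info_state G j h) = legal G j w" "info_state G j h \<in> acting_info_states G j"
      by (simp_all add: legal_at_eq w_def acting_info_states_def)
    moreover have "j \<in> players G" using that J by blast
    ultimately show ?thesis using \<pi> unfolding is_profile_iff by metis
  qed
  have "(\<Sum>b\<in>partial_legal G w i. \<Prod>j\<in>players G - {i}. ?p b j) =
      (\<Sum>f\<in>?F. \<Prod>j\<in>players G - {i}. ?p (m f) j)"
    unfolding partial by (simp add: sum.reindex[OF inj])
  also have "\<dots> = (\<Sum>f\<in>?F. \<Prod>j\<in>J. \<pi> j (info_state G j h) (f j))"
    using J by (intro sum.cong prod.mono_neutral_cong_right) (auto simp: m_def)
  also have "\<dots> = (\<Prod>j\<in>J. \<Sum>x\<in>legal G j w. \<pi> j (info_state G j h) x)"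
    by (rule prod_sum_PiE[OF finJ, symmetric]) (rule finL)
  also have "\<dots> = 1" using one by simp
  finally show "(\<Sum>b\<in>partial_legal G w i. \<Prod>j\<in>players G - {i}. ?p b j) = 1" .
qed

lemma info_histories_acts_in:
  assumes "i \<in> players G" "s \<in> acting_info_states G i" "h \<in> info_histories G i s"
  shows "h \<in> acts_in G i"
proof -
  obtain g where "g \<in> acts_in G i" "info_state G i g = s"
    using assms(2) by (auto simp: acting_info_states_def)
  then show ?thesis
    using assms(3) acts_in_info_state_cong[OF assms(1), of g h] by (simp add: info_histories_def)
qed

text \<open>A node of i consists of a history of s and the pending choices of the players before i:
  together these fix the last state and hence the node, and every legal combination occurs.\<close>

lemma bij_betw_infoset:
  assumes "i \<in> players G" "s \<in> acting_info_states G i"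
  shows "bij_betw (\<lambda>g. (unserialize G g, chosen (last_state (serialize G) g))) (infoset_map G i s)
    (Sigma (info_histories G i s) (\<lambda>h. partial_legal G (last_state G h) i))"
  unfolding bij_betw_def
proof (intro conjI inj_onI equalityI subsetI)
  fix g g' assume g: "g \<in> infoset_map G i s" "g' \<in> infoset_map G i s"
    "(unserialize G g, chosen (last_state (serialize G) g)) =
     (unserialize G g', chosen (last_state (serialize G) g'))"
  obtain b where b: "g \<in> histories (serialize G)"
    "last_state (serialize G) g = Decide (last_state G (unserialize G g)) i b"
    using g(1) by (rule infoset_mapD)
  obtain b' where b': "g' \<in> histories (serialize G)"
    "last_state (serialize G) g' = Decide (last_state G (unserialize G g')) i b'"
    using g(2) by (rule infoset_mapD)
  show "g = g'" using serial_history_unique[OF b(1) b'(1)] b(2) b'(2) g(3) by simp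
next
  fix x assume "x \<in> (\<lambda>g. (unserialize G g, chosen (last_state (serialize G) g))) ` infoset_map G i s"
  then obtain g where g: "g \<in> infoset_map G i s"
    "x = (unserialize G g, chosen (last_state (serialize G) g))" by blast
  from g(1) obtain b where "unserialize G g \<in> acts_in G i" "info_state G i (unserialize G g) = s"
    "last_state (serialize G) g = Decide (last_state G (unserialize G g)) i b"
    "b \<in> partial_legal G (last_state G (unserialize G g)) i" by (rule infoset_mapD)
  then show "x \<in> Sigma (info_histories G i s) (\<lambda>h. partial_legal G (last_state G h) i)"
    unfolding g(2) by (simp add: info_histories_def acts_in_def)
next
  fix x assume "x \<in> Sigma (info_histories G i s) (\<lambda>h. partial_legal G (last_state G h) i)"
  then obtain h b where x: "x = (h, b)" "h \<in> info_histories G i s"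
    "b \<in> partial_legal G (last_state G h) i" by blast
  from info_histories_acts_in[OF assms x(2)] x(3) obtain g where
    "g \<in> acts_in (serialize G) i" "unserialize G g = h"
    "last_state (serialize G) g = Decide (last_state G h) i b"
    by (rule serial_node_exists)
  moreover from this have "g \<in> infoset_map G i s"
    using x(2) by (simp add: infoset_map_def info_histories_def)
  ultimately show "x \<in> (\<lambda>g. (unserialize G g, chosen (last_state (serialize G) g))) ` infoset_map G i s"
    unfolding x(1) by (metis (no_types, lifting) chosen_simps(1) image_eqI)
qed

lemma efg_others_reach_info_eq:
  assumes \<pi>: "is_profile G \<pi>" and nonneg: "\<And>j s x. 0 \<le> \<pi> j s x" and \<sigma>: "corresponds \<pi> \<sigma>"
    and i: "i \<in> players G" and s: "s \<in> acting_info_states G i"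
  shows "efg_others_reach_info (classical_efg G) \<sigma> i (infoset_map G i s) = others_reach_info G \<pi> i s"
proof -
  let ?H = "info_histories G i s" and ?B = "\<lambda>h. partial_legal G (last_state G h) i"
  define K where "K = (\<lambda>h b. \<Prod>j\<in>players G - {i}.
    case b j of None \<Rightarrow> 1 | Some x \<Rightarrow> \<pi> j (info_state G j h) x)"
  define F where "F = (\<lambda>(h, b). others_reach G \<pi> i 0 h * K h b)"
  have "efg_others_reach_info (classical_efg G) \<sigma> i (infoset_map G i s) =
      (\<Sum>\<^sub>\<infinity>g\<in>infoset_map G i s. F (unserialize G g, chosen (last_state (serialize G) g)))"
    unfolding efg_others_reach_info_def
    by (rule infsum_cong)
      (auto simp: F_def K_def efg_others_reach_unserialize[OF \<sigma>] elim: infoset_mapD)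
  also have "\<dots> = infsum F (Sigma ?H ?B)"
    by (rule infsum_reindex_bij_betw[OF bij_betw_infoset[OF i s]])
  also have "\<dots> = (\<Sum>\<^sub>\<infinity>h\<in>?H. others_reach G \<pi> i 0 h)"
  proof (rule infsumI, rule has_sum_SigmaI)
    show B: "((\<lambda>b. F (h, b)) has_sum others_reach G \<pi> i 0 h) (?B h)" if "h \<in> ?H" for h
    proof -
      have h: "h \<in> histories G" using that by (simp add: info_histories_def)
      have "(\<Sum>b\<in>?B h. F (h, b)) = others_reach G \<pi> i 0 h"
        unfolding F_def K_def using sum_partial_legal[OF \<pi> h, of i] by (simp flip: sum_distrib_left)
      then show ?thesis
        using has_sum_finite[OF finite_partial_legal[OF \<pi> h], of "\<lambda>b. F (h, b)" i] by simp
    qed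
    obtain c where c: "\<forall>h\<in>?H. cum_reward G i h = c" using info_histories_reward[OF i] by blast
    \<comment> \<open>The by-product of \<open>follow_value_total\<close>, taken for
      \<open>u = s\<close>.\<close>
    have summ: "others_reach G \<pi> i 0 summable_on ?H"
      by (rule follow_value_total(2)[OF \<pi> i c, of s]) simp
    then show "(others_reach G \<pi> i 0 has_sum (\<Sum>\<^sub>\<infinity>h\<in>?H. others_reach G \<pi> i 0 h)) ?H"
      by simp
    \<comment> \<open>Iterated summability yields joint summability because F is nonnegative; the
      global assumption on \<open>\<pi>\<close> gives this for every b.\<close>
    show "F summable_on Sigma ?H ?B"
    proof (rule summable_on_SigmaI[OF B summ])
      fix h b
      have "0 \<le> K h b" unfolding K_def by (rule prod_nonneg) (simp add: nonneg split: option.split)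
      then show "0 \<le> F (h, b)"
        using others_reach_nonneg[where \<pi> = \<pi> and G = G, OF nonneg] by (simp add: F_def)
    qed
  qed
  finally show ?thesis by (simp add: others_reach_info_def)
qed

text \<open>In contrast to \<open>follow_value\<close>, the counterfactual reach of g is already
  included in the weight and the rewards are cumulative, as in the utilities.\<close>

definition efg_follow_value ::
    "('a, ('a, 'o) entry list) profile \<Rightarrow> nat \<Rightarrow> ('a, 'o) entry list \<Rightarrow>
     (('w, 'a) sstate, 'a) history \<Rightarrow> real" where
  "efg_follow_value \<pi> i u g = (\<Sum>\<^sub>\<infinity>z\<in>{z \<in> terminal_histories (serialize G). prefix g z}.
     reach G (follow \<pi> i u) 0 (unserialize G z) * cum_reward G i (unserialize G z))"

lemma efg_value_hist_follow:
  assumes \<sigma>: "corresponds \<pi> \<sigma>" and i: "i \<in> players G" and g: "g \<in> infoset_map G i s"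
  shows "efg_others_reach (classical_efg G) \<sigma> i 0 g * efg_value_hist (classical_efg G) \<sigma> i g =
    efg_follow_value \<pi> i s g"
  unfolding efg_value_hist_def efg_follow_value_def infsum_cmult_right'[symmetric] classical_efg_simps
proof (rule infsum_cong)
  fix z assume "z \<in> {z \<in> terminal_histories (serialize G). prefix g z}"
  then have z: "z \<in> terminal_histories (serialize G)" "prefix g z" by simp_all
  then obtain r where r: "z = g @ r" by (auto elim: prefixE)
  have zh: "z \<in> histories (serialize G)" using z(1) by (simp add: terminal_histories_def)
  show "efg_others_reach (classical_efg G) \<sigma> i 0 g *
      (efg_reach (classical_efg G) \<sigma> (length g) z * cum_reward (serialize G) i z) =
    reach G (follow \<pi> i s) 0 (unserialize G z) * cum_reward G i (unserialize G z)"
    using leaf_reach[OF \<sigma> i g z, of "[]"] serial_reach_follow_beyond[OF g, of \<pi> r]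
    by (simp add: efg_reach_others[OF \<sigma> zh i] cum_reward_serialize[OF zh] flip: r)
qed

lemma infoset_not_terminal: "g \<in> infoset_map G i s \<Longrightarrow> g \<notin> terminal_histories (serialize G)"
  by (auto simp: infoset_map_def acts_in_def terminal_histories_def terminal_def)

lemma efg_q_hist_follow:
  assumes \<sigma>: "corresponds \<pi> \<sigma>" and i: "i \<in> players G" and g: "g \<in> infoset_map G i s"
  shows "efg_others_reach (classical_efg G) \<sigma> i 0 g * efg_q_hist (classical_efg G) \<sigma> i g x =
    efg_follow_value \<pi> i (s @ [Act x]) g"
  unfolding efg_q_hist_def efg_follow_value_def infsum_cmult_right'[symmetric] classical_efg_simps
proof (rule infsum_cong_neutral, goal_cases)
  case (1 z)
  then have z: "z \<in> terminal_histories (serialize G)" "prefix g z" by simp_all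
  have "z \<noteq> g" using z(1) infoset_not_terminal[OF g] by blast
  with z(2) obtain e r where r: "z = g @ e # r"
    by (metis append_self_conv list.exhaust prefixE)
  have "z \<in> histories (serialize G)" using z(1) by (simp add: terminal_histories_def)
  moreover have "edge_action (classical_efg G) g e \<noteq> x" using 1 r by (auto simp: strict_prefix_def)
  ultimately have "serial_reach G (follow \<pi> i (s @ [Act x])) i (length g) z = 0"
    using serial_reach_follow_Act[OF g, of e r \<pi> x] by (simp add: r)
  then show ?case using leaf_reach[OF \<sigma> i g z, of "[Act x]"] by simp
next
  case (2 z)
  then show ?case by (auto simp: strict_prefix_def)
next
  case (3 z)
  then have z: "z \<in> terminal_histories (serialize G)" "prefix g z" by simp_all
  from 3 obtain e r where r: "z = g @ e # r" by (auto elim: strict_prefixE')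
  have zh: "z \<in> histories (serialize G)" using z(1) by (simp add: terminal_histories_def)
  moreover have "edge_action (classical_efg G) g e = x" using 3 r by simp
  ultimately have "serial_reach G (follow \<pi> i (s @ [Act x])) i (length g) z =
      efg_player_reach (classical_efg G) \<sigma> i (Suc (length g)) z"
    using serial_reach_follow_Act[OF g, of e r \<pi> x] by (simp add: r efg_player_reach_eq[OF \<sigma> i])
  then show ?case
    using leaf_reach[OF \<sigma> i g z, of "[Act x]"] by (simp add: cum_reward_serialize[OF zh])
qed

text \<open>For the inclusion from right to left, z has to be lifted along a path through a node of
  i. Such a path exists because z goes beyond h, where i acts.\<close>

lemma unserialize_terminals_through:
  assumes "i \<in> players G" "s \<in> acting_info_states G i"
  shows "unserialize G ` (\<Union>g\<in>infoset_map G i s. {z \<in> terminal_histories (serialize G). prefix g z}) =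
    terminals_through (info_histories G i s)"
proof (intro equalityI subsetI)
  fix z assume "z \<in> unserialize G `
    (\<Union>g\<in>infoset_map G i s. {z \<in> terminal_histories (serialize G). prefix g z})"
  then obtain g z' where g: "g \<in> infoset_map G i s" "z' \<in> terminal_histories (serialize G)"
    "prefix g z'" "z = unserialize G z'" by blast
  have "unserialize G z' \<in> terminal_histories G" using g(2) by (rule serial_terminalD)
  moreover have "prefix (unserialize G g) (unserialize G z')"
    using g(3) by (metis prefixE prefixI unserialize_append)
  moreover have "unserialize G g \<in> info_histories G i s"
    using g(1) serial_history_unserialize by (simp add: infoset_map_def info_histories_def acts_in_def)
  ultimately show "z \<in> terminals_through (info_histories G i s)"
    unfolding terminals_through_def g(4) by blast
next
  fix z assume "z \<in> terminals_through (info_histories G i s)"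
  then obtain h where h: "h \<in> info_histories G i s" "z \<in> terminal_histories G" "prefix h z"
    by (auto simp: terminals_through_def)
  have acts: "h \<in> acts_in G i" using info_histories_acts_in[OF assms h(1)] .
  then have "z \<noteq> h" using h(2) acts_in_not_terminal by blast
  with h(3) obtain e r where r: "z = h @ e # r"
    by (metis append_self_conv list.exhaust prefixE)
  have "h @ e # r \<in> histories G" using h(2) by (simp add: r terminal_histories_def)
  with acts obtain g g' where g: "g \<in> acts_in (serialize G) i" "unserialize G g = h"
    "g' \<in> histories (serialize G)" "prefix g g'" "unserialize G g' = h @ e # r"
    "last_state (serialize G) g' = entry_state G (last_state G (h @ e # r))"
    by (rule serial_path_exists)
  have "g \<in> infoset_map G i s" using g(1,2) h(1) by (simp add: infoset_map_def info_histories_def)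
  moreover have "g' \<in> terminal_histories (serialize G)"
    using g(3,6) h(2) terminal_entry_state by (simp add: r terminal_histories_def)
  ultimately show "z \<in> unserialize G `
      (\<Union>g\<in>infoset_map G i s. {z \<in> terminal_histories (serialize G). prefix g z})"
    using g(4,5) r by (intro image_eqI[of _ _ g'] UN_I[of g]) simp_all
qed

text \<open>The leaves above different nodes of the information set are disjoint, so the double sum
  is one sum over leaves, reindexed by the injective \<open>unserialize\<close>. No reward constant
  arises, since utilities are cumulative from the start.\<close>

lemma efg_follow_value_total:
  assumes \<pi>: "is_profile G \<pi>" and i: "i \<in> players G" and s: "s \<in> acting_info_states G i"
    and u: "u = s \<or> (\<exists>x\<in>legal_at G i s. u = s @ [Act x])"
  shows "(\<Sum>\<^sub>\<infinity>g\<in>infoset_map G i s. efg_follow_value \<pi> i u g) =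
    (\<Sum>\<^sub>\<infinity>z\<in>terminals_through (info_histories G i s).
       reach G (follow \<pi> i u) 0 z * cum_reward G i z)"
proof -
  let ?T = "\<lambda>g. {z \<in> terminal_histories (serialize G). prefix g z}"
  let ?Z = "\<Union>g\<in>infoset_map G i s. ?T g"
  define f where "f = (\<lambda>z. reach G (follow \<pi> i u) 0 z * cum_reward G i z)"
  have inj: "inj_on (unserialize G) ?Z"
    by (rule inj_on_subset[OF inj_on_unserialize_terminal]) blast
  have disj: "disjoint_family_on ?T (infoset_map G i s)"
    unfolding disjoint_family_on_def using infoset_map_antichain by blast
  obtain h where "h \<in> histories G" "s = info_state G i h"
    using s by (auto simp: acting_info_states_def acts_in_def)
  then have "followable i u" unfolding followable_def using u by blast
  then have "is_profile G (follow \<pi> i u)" using \<pi> is_profile_follow by blast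
  then have "f summable_on terminals_through (info_histories G i s)"
    unfolding f_def using i by (intro summable_reach_reward) (auto simp: terminals_through_def)
  then have "(f \<circ> unserialize G) summable_on ?Z"
    using summable_on_reindex[OF inj, of f] unfolding unserialize_terminals_through[OF i s] by blast
  from infsum_disjoint_Union[OF disj this]
  have "(\<Sum>\<^sub>\<infinity>g\<in>infoset_map G i s. efg_follow_value \<pi> i u g) = infsum (f \<circ> unserialize G) ?Z"
    by (simp add: efg_follow_value_def f_def)
  also have "\<dots> = infsum f (terminals_through (info_histories G i s))"
    using infsum_reindex[OF inj, of f] unfolding unserialize_terminals_through[OF i s] by simp
  finally show ?thesis by (simp add: f_def)
qed

lemma efg_regret_eq:
  assumes \<pi>: "is_profile G \<pi>" and nonneg: "\<And>j s x. 0 \<le> \<pi> j s x" and \<sigma>: "corresponds \<pi> \<sigma>"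
    and i: "i \<in> players G" and s: "s \<in> acting_info_states G i" and x: "x \<in> legal_at G i s"
  shows "efg_q_cf (classical_efg G) \<sigma> i (infoset_map G i s) x -
      efg_value_cf (classical_efg G) \<sigma> i (infoset_map G i s) =
    q_cf G \<pi> i s x - value_cf G \<pi> i s"
proof (cases "others_reach_info G \<pi> i s = 0")
  case True
  \<comment> \<open>The total reach is a factor of all four counterfactual values, so both regrets
    are 0.\<close>
  then show ?thesis
    using efg_others_reach_info_eq[OF \<pi> nonneg \<sigma> i s]
    by (simp add: efg_q_cf_def efg_value_cf_def q_cf_def value_cf_def)
next
  case False
  let ?E = "classical_efg G" and ?I = "infoset_map G i s"
  have P: "efg_others_reach_info ?E \<sigma> i ?I \<noteq> 0"
    using False efg_others_reach_info_eq[OF \<pi> nonneg \<sigma> i s] by simp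
  have cancel: "efg_others_reach_info ?E \<sigma> i ?I * (\<Sum>\<^sub>\<infinity>g\<in>?I. efg_belief ?E \<sigma> i ?I g * v g) =
      (\<Sum>\<^sub>\<infinity>g\<in>?I. efg_others_reach ?E \<sigma> i 0 g * v g)" for v
    unfolding infsum_cmult_right'[symmetric] using P by (intro infsum_cong) (simp add: efg_belief_def)
  have "efg_q_cf ?E \<sigma> i ?I x = (\<Sum>\<^sub>\<infinity>g\<in>?I. efg_follow_value \<pi> i (s @ [Act x]) g)"
    unfolding efg_q_cf_def efg_q_info_def cancel
    by (rule infsum_cong) (rule efg_q_hist_follow[OF \<sigma> i])
  moreover have "efg_value_cf ?E \<sigma> i ?I = (\<Sum>\<^sub>\<infinity>g\<in>?I. efg_follow_value \<pi> i s g)"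
    unfolding efg_value_cf_def efg_value_info_def cancel
    by (rule infsum_cong) (rule efg_value_hist_follow[OF \<sigma> i])
  ultimately show ?thesis
    using x by (simp add: efg_follow_value_total[OF \<pi> i s] regret_eq[OF \<pi> i s x False])
qed

section \<open>Actions at information sets and induction over the iterations\<close>

lemma efg_legal_eq:
  assumes s: "s \<in> acting_info_states G i"
  shows "efg_legal (classical_efg G) (infoset_map G i s) = legal_at G i s"
proof (intro equalityI subsetI)
  fix x assume "x \<in> efg_legal (classical_efg G) (infoset_map G i s)"
  then obtain g e where g: "g \<in> infoset_map G i s" "g @ [e] \<in> histories (serialize G)"
    "x = edge_action (classical_efg G) g e" by (auto simp: efg_legal_def)
  from g(1) obtain b where b: "unserialize G g \<in> acts_in G i"
    "info_state G i (unserialize G g) = s"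
    "last_state (serialize G) g = Decide (last_state G (unserialize G g)) i b" by (rule infoset_mapD)
  from g(2) have "x \<in> legal G i (last_state G (unserialize G g))"
    by (cases rule: serial_cases) (use b(3) g(3) in \<open>auto simp: edge_action_simp\<close>)
  then show "x \<in> legal_at G i s" using legal_at_eq[OF b(1)] b(2) by simp
next
  fix x assume x: "x \<in> legal_at G i s"
  obtain g where g: "g \<in> infoset_map G i s"
    using s unfolding acting_info_states_serial infoset_map_def by blast
  then obtain b where b: "g \<in> histories (serialize G)" "unserialize G g \<in> acts_in G i"
    "info_state G i (unserialize G g) = s"
    "last_state (serialize G) g = Decide (last_state G (unserialize G g)) i b" by (rule infoset_mapD)
  let ?w = "last_state G (unserialize G g)" and ?d = "noops(i := Some x)"
  have xl: "x \<in> legal G i ?w" using x legal_at_eq[OF b(2)] b(3) by simp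
  have "i \<in> players G"
    using b(2) active_subset last_state_states by (metis (mono_tags, lifting) acts_in_def mem_Collect_eq)
  then have "?d \<in> joint_legal (serialize G) (Decide ?w i b)"
    using xl by (auto simp: joint_legal_def moves_def)
  then have "g @ [(?d, next_state G ?w i (b(i := Some x)))] \<in> histories (serialize G)"
    using histories.snoc[OF b(1), of ?d] by (simp add: b(4))
  moreover have "edge_action (classical_efg G) g (?d, next_state G ?w i (b(i := Some x))) = x"
    by (simp add: edge_action_simp[OF b(4)])
  ultimately show "x \<in> efg_legal (classical_efg G) (infoset_map G i s)"
    unfolding efg_legal_def classical_efg_simps using g
    by (intro CollectI exI[of _ g] exI[of _ "(?d, next_state G ?w i (b(i := Some x)))"]) simp
qed

text \<open>Strong induction, since the regrets at time t involve all earlier profiles. They agree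
  at legal actions only, which is all that \<open>regret_matching\<close> looks at.\<close>

lemma corresponds_cfr: "corresponds (cfr G t) (efg_cfr (classical_efg G) t)"
proof (induction t rule: less_induct)
  case (less t)
  show ?case
    unfolding corresponds_def
  proof (intro ballI)
    fix i s assume i: "i \<in> players G" and s: "s \<in> acting_info_states G i"
    have "(\<Sum>k<t. efg_q_cf (classical_efg G) (efg_cfr (classical_efg G) k) i (infoset_map G i s) x -
          efg_value_cf (classical_efg G) (efg_cfr (classical_efg G) k) i (infoset_map G i s)) =
        (\<Sum>k<t. q_cf G (cfr G k) i s x - value_cf G (cfr G k) i s)" if "x \<in> legal_at G i s" for x
      using efg_regret_eq[OF is_profile_cfr cfr_nonneg less i s that] by (intro sum.cong) auto
    then show "efg_cfr (classical_efg G) t i (infoset_map G i s) = cfr G t i s"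
      unfolding efg_cfr_eq[of _ t] cfr_eq[of _ t] efg_legal_eq[OF s] by (rule regret_matching_cong)
  qed
qed

end

theorem theorem4p1:
  fixes G :: "('w::topological_space, 'a::topological_space, 'o) fosg"
  assumes "FOSG G"
    and "finite_actions G"
    and "integrable_rewards G"
    and "observable_rewards G"
  shows "\<forall>i\<in>players G.
    bij_betw (infoset_map G i) (acting_info_states G i) (infosets (classical_efg G) i) \<and>
    (\<forall>s\<in>acting_info_states G i. \<forall>t.
       cfr G t i s = efg_cfr (classical_efg G) t i (infoset_map G i s))"
proof -
  interpret FOSG_cfr G
    using assms by (simp add: FOSG_cfr_def FOSG_cfr_axioms_def)
  show ?thesis
    using corresponds_cfr inj_on_infoset_map
    by (simp add: bij_betw_def infosets_eq corresponds_def del: classical_efg_simps(6))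
qed

end
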